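(* Let $[A,(B_{::})]$ be an array of $q\ge 2$ linear time-invariant systems with relative actuation, and let $\mu_1,\dots,\mu_m$ be the distinct eigenvalues of $A^{*}$ with associated eigenvector matrices $V_1,\dots,V_m$ (all as defined in the context). The array $[A,(B_{::})]$ is positively controllable if and only if the following two conditions simultaneously hold. 1. The array $[A,(B_{::})]$ is controllable. 2. $\mathrm{inc}(V_\kappa^{*}B_{::})$ is strongly connected for all $\kappa$ with $\mu_\kappa\in\mathbb{R}$.
   Context: Array. Let $q\ge 2$, $n,p\ge 1$ be integers, $A\in\mathbb{R}^{n\times n}$, and $B_{i\sigma}\in\mathbb{R}^{n\times 1}$ ($i=1,\dots,q$; $\sigma=1,\dots,p$) satisfying $\sum_{i=1}^{q}B_{i\sigma}=0$ for every $\sigma$ (relative actuation). The array $[A,(B_{::})]$ is the collection of systems $\dot x_i=Ax_i+\sum_{\sigma=1}^{p}B_{i\sigma}u_\sigma$, $i=1,\dots,q$, with states $x_i\in\mathbb{R}^n$ and scalar inputs $u_\sigma\in\mathbb{R}$. Input signals are (Lebesgue) integrable functions on bounded intervals. Controllability. The array is controllable if for each set of initial conditions $(x_1(0),\dots,x_q(0))$ there exist a finite time $\tau>0$ and input signals $u_\sigma:[0,\tau]\to\mathbb{R}$ such that $x_i(\tau)=x_j(\tau)$ for all $(i,j)$. It is positively controllable if the input signals can be chosen to satisfy $u_\sigma:[0,\tau]\to\mathbb{R}_{\ge 0}$. Incidence matrix. $M^{*}$ denotes the conjugate transpose of $M$. For a collection of matrices $(C_{i\sigma})_{i=1,\dots,q;\,\sigma=1,\dots,p}$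 of equal size, $\mathrm{inc}(C_{::})$ is the block matrix whose $(i,\sigma)$ block is $C_{i\sigma}$. For a matrix $M$, $(MB_{::})$ denotes the collection with members $MB_{i\sigma}$. Eigenvectors. $\mu_1,\dots,\mu_m$ are the distinct eigenvalues of $A^{*}$. For each $\kappa$, $V_\kappa\in\mathbb{C}^{n\times d_\kappa}$ is a full column rank matrix with $\mathrm{range}\,V_\kappa=\mathrm{null}(A^{*}-\mu_\kappa I_n)$, taken real when $\mu_\kappa\in\mathbb{R}$. Strong connectedness. For a positive integer $d$, $\mathcal{S}_d=\mathrm{range}(\mathbf{1}_q\otimes I_d)$, where $\mathbf{1}_q$ is the $q$-vector of all ones, and $\mathcal{S}_d^{\perp}$ is its orthogonal complement. A matrix $G$ with $qd$ rows belongs to class-$\mathcal{G}_d$ if $\mathrm{range}\,G\subset\mathcal{S}_d^{\perp}$. For a real matrix $G$, $\mathrm{cone}\,G=\{G\alpha:\alpha\ge 0\}$ with $\alpha\ge0$ entrywise. A real class-$\mathcal{G}_d$ matrix $G$ is strongly connected if $\mathrm{cone}\,G\supset\mathcal{S}_d^{\perp}$. Here $\mathrm{inc}(V_\kappa^{*}B_{::})\in\mathcal{G}_{d_\kappa}$. *)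

theory Defs
  imports "HOL-Analysis.Analysis"
begin

section \<open>Arrays with relative actuation\<close>

text \<open>
  Systems are indexed by the finite type \<open>'q\<close>, inputs by \<open>'p\<close> and state coordinates by \<open>'n\<close>;
  the column \<open>B i s\<close> is the \<open>n \<times> 1\<close> matrix through which input \<open>s\<close> acts on system \<open>i\<close>.
\<close>

definition relative_actuation :: "('q::finite \<Rightarrow> 'p::finite \<Rightarrow> real^'n) \<Rightarrow> bool" where
  "relative_actuation B \<longleftrightarrow> (\<forall>s. (\<Sum>i\<in>UNIV. B i s) = 0)"

text \<open>
  Inputs are only integrable, so solutions are meant in the sense of Caratheodory. The integral
  equation for all \<open>t\<close> in \<open>[0, T]\<close> expresses this; it forces \<open>x i\<close> to be continuous with
  \<open>x i 0 = x0 i\<close>, and then the integrand is Lebesgue integrable.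
\<close>

definition array_solution ::
  "real^'n^'n \<Rightarrow> ('q \<Rightarrow> 'p::finite \<Rightarrow> real^'n) \<Rightarrow> real \<Rightarrow> ('p \<Rightarrow> real \<Rightarrow> real)
    \<Rightarrow> ('q \<Rightarrow> real^'n) \<Rightarrow> ('q \<Rightarrow> real \<Rightarrow> real^'n) \<Rightarrow> bool" where
  "array_solution A B T u x0 x \<longleftrightarrow>
    (\<forall>i. \<forall>t\<in>{0..T}.
      ((\<lambda>r. A *v x i r + (\<Sum>s\<in>UNIV. u s r *\<^sub>R B i s)) has_integral (x i t - x0 i)) {0..t})"

definition controllable :: "real^'n^'n \<Rightarrow> ('q \<Rightarrow> 'p::finite \<Rightarrow> real^'n) \<Rightarrow> bool" where
  "controllable A B \<longleftrightarrow>
    (\<forall>x0. \<exists>T>0. \<exists>u x.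
      (\<forall>s. u s absolutely_integrable_on {0..T}) \<and>
      array_solution A B T u x0 x \<and> (\<forall>i j. x i T = x j T))"

definition positively_controllable :: "real^'n^'n \<Rightarrow> ('q \<Rightarrow> 'p::finite \<Rightarrow> real^'n) \<Rightarrow> bool" where
  "positively_controllable A B \<longleftrightarrow>
    (\<forall>x0. \<exists>T>0. \<exists>u x.
      (\<forall>s. u s absolutely_integrable_on {0..T}) \<and> (\<forall>s. \<forall>t\<in>{0..T}. 0 \<le> u s t) \<and>
      array_solution A B T u x0 x \<and> (\<forall>i j. x i T = x j T))"

section \<open>Eigenvector matrices\<close>

definition conj_transpose :: "complex^'m^'n \<Rightarrow> complex^'n^'m" where
  "conj_transpose M = (\<chi> i j. cnj (M $ j $ i))"

definition eigenvalue :: "complex^'n^'n \<Rightarrow> complex \<Rightarrow> bool" where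
  "eigenvalue M z \<longleftrightarrow> (\<exists>v. v \<noteq> 0 \<and> M *v v = z *s v)"

definition null_space :: "complex^'n^'m \<Rightarrow> (complex^'n) set" where
  "null_space M = {v. M *v v = 0}"

text \<open>
  The number \<open>d\<close> of columns of an eigenvector matrix depends on the eigenvalue and so cannot be
  a type. Such a matrix is given by its columns \<open>V 0, \<dots>, V (d - 1)\<close>; the values of \<open>V\<close> from \<open>d\<close>
  on play no role.
\<close>

definition column_range :: "nat \<Rightarrow> (nat \<Rightarrow> complex^'n) \<Rightarrow> (complex^'n) set" where
  "column_range d V = {\<Sum>j<d. z j *s V j | z. True}"

definition full_column_rank :: "nat \<Rightarrow> (nat \<Rightarrow> complex^'n) \<Rightarrow> bool" where
  "full_column_rank d V \<longleftrightarrow> vec.dim (V ` {..<d}) = d"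

definition eigenvector_matrix :: "complex^'n^'n \<Rightarrow> complex \<Rightarrow> nat \<Rightarrow> (nat \<Rightarrow> complex^'n) \<Rightarrow> bool" where
  "eigenvector_matrix M z d V \<longleftrightarrow>
    full_column_rank d V \<and> column_range d V = null_space (M - mat z) \<and>
    (z \<in> \<real> \<longrightarrow> (\<forall>j<d. \<forall>k. V j $ k \<in> \<real>))"

text \<open>The product of the conjugate transpose of \<open>V\<close> with a real column vector.\<close>

definition conj_transpose_mult :: "(nat \<Rightarrow> complex^'n) \<Rightarrow> real^'n \<Rightarrow> nat \<Rightarrow> complex" where
  "conj_transpose_mult V b = (\<lambda>j. \<Sum>k\<in>UNIV. cnj (V j $ k) * complex_of_real (b $ k))"

section \<open>Strong connectedness\<close>

text \<open>
  A \<open>qd\<close>-dimensional vector is indexed by pairs (block \<open>i\<close>, position \<open>j < d\<close> within the block) and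
  is a function that vanishes off \<open>block_rows d\<close>. A matrix is a function of a row and a column
  index, looked at only on explicit index sets \<open>R\<close> and \<open>C\<close>.
\<close>

definition block_rows :: "nat \<Rightarrow> ('q \<times> nat) set" where
  "block_rows d = UNIV \<times> {..<d}"

definition block_space :: "nat \<Rightarrow> ('q \<times> nat \<Rightarrow> real) set" where
  "block_space d = {w. \<forall>r. r \<notin> block_rows d \<longrightarrow> w r = 0}"

definition mat_apply :: "'r set \<Rightarrow> 'c set \<Rightarrow> ('r \<Rightarrow> 'c \<Rightarrow> real) \<Rightarrow> ('c \<Rightarrow> real) \<Rightarrow> 'r \<Rightarrow> real" where
  "mat_apply R C G z = (\<lambda>r. if r \<in> R then \<Sum>c\<in>C. G r c * z c else 0)"

text \<open>The \<open>((i, j), k)\<close> entry of the Kronecker product of the all-ones \<open>q\<close>-vector with the identity.\<close>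

definition ones_kron_id :: "'q \<times> nat \<Rightarrow> nat \<Rightarrow> real" where
  "ones_kron_id = (\<lambda>(i, j) k. 1 * (if j = k then 1 else 0))"

definition S_space :: "nat \<Rightarrow> ('q \<times> nat \<Rightarrow> real) set" where
  "S_space d = range (mat_apply (block_rows d) {..<d} ones_kron_id)"

definition S_perp :: "nat \<Rightarrow> ('q::finite \<times> nat \<Rightarrow> real) set" where
  "S_perp d = {w \<in> block_space d. \<forall>v\<in>S_space d. (\<Sum>r\<in>block_rows d. w r * v r) = 0}"

definition class_G :: "nat \<Rightarrow> ('q::finite \<times> nat \<Rightarrow> 'p::finite \<Rightarrow> real) \<Rightarrow> bool" where
  "class_G d G \<longleftrightarrow> range (mat_apply (block_rows d) UNIV G) \<subseteq> S_perp d"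

definition mat_cone :: "nat \<Rightarrow> ('q \<times> nat \<Rightarrow> 'p::finite \<Rightarrow> real) \<Rightarrow> ('q \<times> nat \<Rightarrow> real) set" where
  "mat_cone d G = {mat_apply (block_rows d) UNIV G a | a. \<forall>s. 0 \<le> a s}"

definition strongly_connected :: "nat \<Rightarrow> ('q::finite \<times> nat \<Rightarrow> 'p::finite \<Rightarrow> real) \<Rightarrow> bool" where
  "strongly_connected d G \<longleftrightarrow> class_G d G \<and> S_perp d \<subseteq> mat_cone d G"

text \<open>
  The members of the collection are column vectors, so that each input contributes a single
  column. The real part serves to view a complex matrix with real entries as a real one.
\<close>

definition inc :: "('q \<Rightarrow> 'p \<Rightarrow> nat \<Rightarrow> 'a) \<Rightarrow> 'q \<times> nat \<Rightarrow> 'p \<Rightarrow> 'a" where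
  "inc C = (\<lambda>(i, j) s. C i s j)"

definition real_matrix :: "('r \<Rightarrow> 'c \<Rightarrow> complex) \<Rightarrow> 'r \<Rightarrow> 'c \<Rightarrow> real" where
  "real_matrix G = (\<lambda>r c. Re (G r c))"

end

theory Submission
  imports Defs
begin

text \<open>
  The inputs enter with zero sum over the systems, so the average of the states evolves as if unforced, and
  synchronization is the steering to zero of the deviations from the average. With
  \<open>e\<^sup>t\<^sup>A\<close> the matrix exponential, an input \<open>u\<close> on \<open>[0, T]\<close> yields
  \<open>x\<^sub>i(T) = e\<^sup>T\<^sup>A (x\<^sub>i(0) + y\<^sub>i)\<close>, where the displacement
  \<open>y\<^sub>i = \<integral> e\<^bsup>-rA\<^esup> \<Sum>\<^sub>s u\<^sub>s(r) B\<^sub>i\<^sub>s dr\<close> does not depend on the initial state. Hence the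
  array is (positively) controllable iff the displacements of all (nonnegative) inputs fill the
  space \<open>W\<close> of block vectors whose blocks sum to zero
  (\<open>synchronizable_iff_displacements\<close>). The proof then follows the pattern of Brammer's theorem on
  linear systems with constrained inputs.

  Necessity of strong connectedness is direct. If \<open>v\<close> is a column of \<open>V\<^sub>\<kappa>\<close> with \<open>\<mu>\<^sub>\<kappa>\<close> real, then
  \<open>v \<bullet> e\<^bsup>-rA\<^esup> b = e\<^bsup>-\<mu>r\<^esup> (v \<bullet> b)\<close>, so the products of the columns with a displacement form the incidence
  matrix applied to the vector of the numbers \<open>\<integral> e\<^bsup>-\<mu>r\<^esup> u\<^sub>s(r) dr \<ge> 0\<close>. As displacements fill
  \<open>W\<close>, these vectors fill the orthogonal complement of the synchronization subspace.

  For sufficiency, suppose that the displacements of nonnegative inputs, which form a convex cone,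
  miss a point of \<open>W\<close>. A separating hyperplane gives a nonzero costate \<open>\<eta> \<in> W\<close> in the dual cone
  \<open>K\<close>, which consists of the costates with
  \<open>\<Sum>\<^sub>i \<eta>\<^sub>i \<bullet> e\<^bsup>-tA\<^esup> B\<^sub>i\<^sub>s \<ge> 0\<close> for all \<open>s\<close> and all \<open>t \<ge> 0\<close> (\<open>dual_cone_nontrivial\<close>). The
  adjoint flow maps \<open>K\<close> into itself, because it only shifts \<open>t\<close>. Controllability makes every
  vector of \<open>W\<close> a difference of two displacements of nonnegative inputs, and so provides a
  linear functional that is positive on \<open>K - {0}\<close> and cuts out a compact base of \<open>K\<close>
  (\<open>controllable_dominating_vector\<close>). Brouwer's theorem, applied to the normalized adjoint flow on
  this base for shorter and shorter times, yields in the limit an eigenvector of the generator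
  (\<open>eigenvector_of_generator\<close>): an \<open>\<eta> \<in> K\<close> all of whose blocks satisfy \<open>A\<^sup>T \<eta>\<^sub>i = \<mu> \<eta>\<^sub>i\<close> for one real \<open>\<mu>\<close>.
  Its coordinates with respect to the columns of \<open>V\<^sub>\<kappa>\<close> form a nonzero vector of the complement that has
  nonnegative inner product with each column of the incidence matrix; the cone of that matrix then
  cannot contain the negative of this vector, against strong connectedness.
\<close>

section \<open>A product rule for indefinite integrals\<close>

text \<open>
  The increments of \<open>F\<close> are bounded by products of two quantities that both vanish with \<open>t - s\<close>, so the
  derivative of \<open>F\<close> is zero at every point.
\<close>

lemma constant_if_increments_dominated:
  fixes F :: "real \<Rightarrow> 'a::real_normed_vector"
  assumes contN: "continuous_on {0..T} N"
    and bound: "\<And>s t. 0 \<le> s \<Longrightarrow> s \<le> t \<Longrightarrow> t \<le> T \<Longrightarrow> norm (F t - F s) \<le> (t - s) * (N t - N s)"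
    and t: "t \<in> {0..T}"
  shows "F t = F 0"
proof -
  have "(F has_derivative (\<lambda>_. 0)) (at s within {0..T})" if s: "s \<in> {0..T}" for s
  proof -
    have bd: "norm ((F y - F s) /\<^sub>R norm (y - s)) \<le> \<bar>N y - N s\<bar>" if y: "y \<in> {0..T}" for y
    proof (cases "y = s")
      case False
      have "norm (F y - F s) \<le> \<bar>y - s\<bar> * \<bar>N y - N s\<bar>"
      proof (cases "s \<le> y")
        case True
        then have "norm (F y - F s) \<le> (y - s) * (N y - N s)"
          using bound s y by auto
        also have "\<dots> \<le> \<bar>y - s\<bar> * \<bar>N y - N s\<bar>"
          by (metis abs_ge_self abs_mult)
        finally show ?thesis .
      next
        case False
        then have "norm (F s - F y) \<le> (s - y) * (N s - N y)"
          using bound s y by auto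
        also have "\<dots> \<le> \<bar>y - s\<bar> * \<bar>N y - N s\<bar>"
          by (metis abs_ge_self abs_mult abs_minus_commute)
        finally show ?thesis by (simp add: norm_minus_commute)
      qed
      moreover have "norm ((F y - F s) /\<^sub>R norm (y - s)) = norm (F y - F s) / \<bar>y - s\<bar>"
        unfolding norm_scaleR by (simp add: divide_inverse_commute)
      ultimately show ?thesis
        using False by (simp add: pos_divide_le_eq mult.commute)
    qed simp
    have "((\<lambda>y. N y - N s) \<longlongrightarrow> 0) (at s within {0..T})"
      using contN s by (auto simp: continuous_on intro: LIM_zero)
    then have "((\<lambda>y. \<bar>N y - N s\<bar>) \<longlongrightarrow> 0) (at s within {0..T})"
      by (rule tendsto_rabs_zero)
    then have "((\<lambda>y. (F y - F s) /\<^sub>R norm (y - s)) \<longlongrightarrow> 0) (at s within {0..T})"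
      by (rule Lim_null_comparison[rotated]) (use bd in \<open>auto simp: eventually_at_filter\<close>)
    then show ?thesis
      by (simp add: has_derivative_within inverse_eq_divide)
  qed
  then obtain c where "\<And>s. s \<in> {0..T} \<Longrightarrow> F s = c"
    using has_derivative_zero_constant[of "{0..T}" F] by auto
  with t show ?thesis by auto
qed

lemma indefinite_integral_increment:
  fixes G :: "real \<Rightarrow> 'a::euclidean_space"
  assumes "G integrable_on {0..T}" "0 \<le> s" "s \<le> t" "t \<le> T"
  shows "integral {0..t} G - integral {0..s} G = integral {s..t} G" "G integrable_on {s..t}"
proof -
  have "G integrable_on {0..t}" using assms by (auto intro: integrable_on_subinterval)
  then show "integral {0..t} G - integral {0..s} G = integral {s..t} G"
    using Henstock_Kurzweil_Integration.integral_combine[OF assms(2,3), of G] by (simp add: algebra_simps)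
  show "G integrable_on {s..t}" using assms by (auto intro: integrable_on_subinterval)
qed

text \<open>
  The integrand \<open>g\<close> is only integrable, so \<open>f\<close> need not be differentiable on a set with
  countable complement and the fundamental theorem of calculus does not apply to the product.
  Instead let \<open>F t\<close> be the difference of \<open>h (\<phi> t) (f t)\<close> and the integral
  up to \<open>t\<close>. The first-order terms of an increment of \<open>F\<close> cancel; what remains is
  \<open>\<integral>\<^sub>s\<^sup>t h (\<phi>' r) (f t - f r) + h (\<phi> s - \<phi> r) (g r) dr\<close>, which is bounded by a multiple of
  \<open>(t - s) \<integral>\<^sub>s\<^sup>t \<parallel>g\<parallel>\<close>. So \<open>F\<close> is constant by
  \<open>constant_if_increments_dominated\<close>.

  With \<open>h\<close> the product of a matrix and a vector, this lemma gives both directions of the variation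
  of constants formula.
\<close>

lemma indefinite_integral_product_rule:
  fixes h :: "'a::euclidean_space \<Rightarrow> 'b::euclidean_space \<Rightarrow> 'c::euclidean_space"
  assumes bil: "bounded_bilinear h"
    and \<phi>: "\<And>t. t \<in> {0..T} \<Longrightarrow> (\<phi> has_vector_derivative \<phi>' t) (at t within {0..T})"
    and cont\<phi>': "continuous_on {0..T} \<phi>'"
    and g: "g absolutely_integrable_on {0..T}"
    and f: "\<And>t. t \<in> {0..T} \<Longrightarrow> (g has_integral (f t - f 0)) {0..t}"
    and T: "0 \<le> T"
  shows "((\<lambda>r. h (\<phi>' r) (f r) + h (\<phi> r) (g r)) has_integral (h (\<phi> T) (f T) - h (\<phi> 0) (f 0))) {0..T}"
proof -
  interpret h: bounded_bilinear h by (fact bil)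
  obtain K where K: "K > 0" "\<And>a b. norm (h a b) \<le> norm a * norm b * K"
    using h.pos_bounded by blast
  obtain L where L: "L > 0" "\<And>r. r \<in> {0..T} \<Longrightarrow> norm (\<phi>' r) \<le> L"
    using compact_imp_bounded[OF compact_continuous_image[OF cont\<phi>' compact_Icc]]
    by (auto simp: bounded_pos)
  have cont\<phi>: "continuous_on {0..T} \<phi>"
    by (auto simp: continuous_on_eq_continuous_within intro: has_vector_derivative_continuous[OF \<phi>])
  have g_int: "g integrable_on {0..T}" and ng_int: "(\<lambda>r. norm (g r)) integrable_on {0..T}"
    using g by (auto simp: absolutely_integrable_on_def)
  obtain c where f_eq: "\<And>t. t \<in> {0..T} \<Longrightarrow> f t = c + integral {0..t} g"
    using f by (metis add.commute diff_eq_eq integral_unique)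
  have contf: "continuous_on {0..T} f"
    using continuous_on_add[OF continuous_on_const indefinite_integral_continuous_1[OF g_int], of c]
    by (rule continuous_on_eq) (rule f_eq[symmetric])
  define H where "H = (\<lambda>r. h (\<phi>' r) (f r) + h (\<phi> r) (g r))"
  have hg: "(\<lambda>r. h (\<phi> r) (g r)) absolutely_integrable_on {0..T}"
  proof (rule absolutely_integrable_bounded_measurable_product[where h = h, OF _ _ _ _ g])
    show "bilinear h" using bil by (simp add: bilinear_conv_bounded_bilinear)
    show "\<phi> \<in> borel_measurable (lebesgue_on {0..T})"
      by (rule continuous_imp_measurable_on_sets_lebesgue[OF cont\<phi>]) auto
    show "bounded (\<phi> ` {0..T})"
      using compact_continuous_image[OF cont\<phi>] by (simp add: compact_imp_bounded)
  qed auto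
  have hf: "continuous_on {0..T} (\<lambda>r. h (\<phi>' r) (f r))"
    by (rule h.continuous_on[OF cont\<phi>' contf])
  have H_int: "H integrable_on {0..T}"
    unfolding H_def
    using integrable_add[OF integrable_continuous_interval[OF hf]
        set_lebesgue_integral_eq_integral(1)[OF hg]] .
  define N where "N = (\<lambda>t. integral {0..t} (\<lambda>r. norm (g r)))"
  define F where "F = (\<lambda>t. h (\<phi> t) (f t) - integral {0..t} H)"
  have contN: "continuous_on {0..T} (\<lambda>t. 2 * K * L * N t)"
    unfolding N_def by (intro continuous_intros indefinite_integral_continuous_1 ng_int)
  have bound: "norm (F t - F s) \<le> (t - s) * (2 * K * L * N t - 2 * K * L * N s)"
    if st: "0 \<le> s" "s \<le> t" "t \<le> T" for s t
  proof -
    have ng: "norm (f b - f a) \<le> N t - N s" if "s \<le> a" "a \<le> b" "b \<le> t" for a b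
    proof -
      have "f b - f a = integral {a..b} g"
        using f_eq indefinite_integral_increment(1)[OF g_int, of a b] that st by auto
      also have "norm \<dots> \<le> integral {a..b} (\<lambda>r. norm (g r))"
        using indefinite_integral_increment(2)[OF g_int, of a b]
          indefinite_integral_increment(2)[OF ng_int, of a b] that st
        by (intro integral_norm_bound_integral) auto
      also have "\<dots> \<le> integral {s..t} (\<lambda>r. norm (g r))"
        using indefinite_integral_increment(2)[OF ng_int] that st by (intro integral_subset_le) auto
      also have "\<dots> = N t - N s"
        unfolding N_def using indefinite_integral_increment(1)[OF ng_int] st by simp
      finally show ?thesis .
    qed
    have \<phi>d: "(\<phi>' has_integral (\<phi> b - \<phi> a)) {a..b}" if "s \<le> a" "a \<le> b" "b \<le> t" for a b
      using that st by (intro fundamental_theorem_of_calculus)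
        (auto intro!: has_vector_derivative_within_subset[OF \<phi>])
    have \<phi>b: "norm (\<phi> b - \<phi> a) \<le> L * (t - s)" if "s \<le> a" "a \<le> b" "b \<le> t" for a b
    proof -
      have "norm (\<phi> b - \<phi> a) \<le> L * measure lborel (cbox a b)"
        by (rule has_integral_bound[of _ \<phi>']) (use \<phi>d[OF that] L that st in auto)
      also have "\<dots> \<le> L * (t - s)" using that L by auto
      finally show ?thesis .
    qed
    have I1: "((\<lambda>r. h (\<phi>' r) (f t)) has_integral (h (\<phi> t - \<phi> s) (f t))) {s..t}"
      using has_integral_linear[OF \<phi>d[of s t] h.bounded_linear_left[of "f t"]] st by (simp add: o_def)
    have "(g has_integral (f t - f s)) {s..t}"
      using f_eq indefinite_integral_increment[OF g_int, of s t] st by (auto simp: has_integral_iff)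
    from has_integral_linear[OF this h.bounded_linear_right[of "\<phi> s"]]
    have I2: "((\<lambda>r. h (\<phi> s) (g r)) has_integral (h (\<phi> s) (f t - f s))) {s..t}"
      by (simp add: o_def)
    have I3: "(H has_integral (integral {0..t} H - integral {0..s} H)) {s..t}"
      using indefinite_integral_increment[OF H_int] st by (auto simp: has_integral_iff)
    have "F t - F s = h (\<phi> t - \<phi> s) (f t) + h (\<phi> s) (f t - f s) - (integral {0..t} H - integral {0..s} H)"
      unfolding F_def by (simp add: h.diff_left h.diff_right)
    then have I: "((\<lambda>r. h (\<phi>' r) (f t) + h (\<phi> s) (g r) - H r) has_integral (F t - F s)) {s..t}"
      using has_integral_diff[OF has_integral_add[OF I1 I2] I3] by simp
    have J: "((\<lambda>r. K * L * (N t - N s) + K * L * (t - s) * norm (g r)) has_integral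
        (t - s) * (2 * K * L * N t - 2 * K * L * N s)) {s..t}"
    proof -
      have "((\<lambda>r. K * L * (t - s) * norm (g r)) has_integral K * L * (t - s) * (N t - N s)) {s..t}"
        using indefinite_integral_increment[OF ng_int, of s t] st unfolding N_def
        by (intro has_integral_mult_right) (auto simp: has_integral_iff)
      from has_integral_add[OF has_integral_const_real this, of "K * L * (N t - N s)"]
      show ?thesis using st by (simp add: algebra_simps)
    qed
    have "norm (F t - F s) = norm (integral {s..t} (\<lambda>r. h (\<phi>' r) (f t) + h (\<phi> s) (g r) - H r))"
      using I by (simp add: integral_unique)
    also have "\<dots> \<le> integral {s..t} (\<lambda>r. K * L * (N t - N s) + K * L * (t - s) * norm (g r))"
    proof (rule integral_norm_bound_integral)
      fix r assume r: "r \<in> {s..t}"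
      have "h (\<phi>' r) (f t) + h (\<phi> s) (g r) - H r = h (\<phi>' r) (f t - f r) - h (\<phi> r - \<phi> s) (g r)"
        by (simp add: H_def h.diff_left h.diff_right)
      also have "norm \<dots> \<le> norm (\<phi>' r) * norm (f t - f r) * K + norm (\<phi> r - \<phi> s) * norm (g r) * K"
        by (rule order_trans[OF norm_triangle_ineq4 add_mono[OF K(2) K(2)]])
      also have "\<dots> \<le> L * (N t - N s) * K + (L * (t - s)) * norm (g r) * K"
        using K(1) L(1) L(2)[of r] ng[of r t] \<phi>b[of s r] r st
        by (intro add_mono mult_right_mono mult_mono) auto
      finally show "norm (h (\<phi>' r) (f t) + h (\<phi> s) (g r) - H r)
          \<le> K * L * (N t - N s) + K * L * (t - s) * norm (g r)"
        by (simp add: algebra_simps)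
    qed (use I J in \<open>auto simp: has_integral_iff\<close>)
    also have "\<dots> = (t - s) * (2 * K * L * N t - 2 * K * L * N s)"
      using J by (rule integral_unique)
    finally show ?thesis .
  qed
  have "F T = F 0"
    using constant_if_increments_dominated[OF contN bound, of T] T by auto
  then have "integral {0..T} H = h (\<phi> T) (f T) - h (\<phi> 0) (f 0)"
    by (simp add: F_def algebra_simps)
  with H_int show ?thesis
    unfolding H_def by (simp add: has_integral_iff)
qed

section \<open>The matrix exponential\<close>

lemma bounded_bilinear_matrix_vector_mult:
  "bounded_bilinear ((*v) :: real^'n^'m \<Rightarrow> real^'n \<Rightarrow> real^'m)"
  unfolding bilinear_conv_bounded_bilinear[symmetric] bilinear_def
  by (auto intro!: linearI simp: matrix_vector_mult_add_rdistrib scaleR_matrix_vector_assoc)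

lemma minus_matrix_vector_mult: "(- M) *v x = - (M *v x)" for M :: "real^'n^'m"
  using matrix_vector_mult_diff_rdistrib[of 0 M x] by simp

primrec matrix_pow :: "real^'n^'n \<Rightarrow> nat \<Rightarrow> real^'n^'n" where
  "matrix_pow A 0 = mat 1"
| "matrix_pow A (Suc k) = A ** matrix_pow A k"

lemma matrix_pow_Suc_right: "matrix_pow A (Suc k) = matrix_pow A k ** A"
  by (induction k) (simp_all add: matrix_mul_assoc)

text \<open>
  Taken entrywise, the exponential series becomes a family of real power series, which can be
  differentiated term by term.
\<close>

definition matrix_exp :: "real^'n^'n \<Rightarrow> real \<Rightarrow> real^'n^'n" where
  "matrix_exp A t = (\<chi> i j. \<Sum>k. matrix_pow A k $ i $ j / fact k * t ^ k)"

lemma matrix_pow_entry_bound: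
  "\<bar>matrix_pow A k $ i $ j\<bar> \<le> (\<Sum>i\<in>UNIV. \<Sum>j\<in>UNIV. \<bar>A $ i $ j\<bar>) ^ k"
proof (induction k arbitrary: i)
  case 0
  then show ?case by (simp add: mat_def)
next
  case (Suc k)
  let ?C = "\<Sum>i\<in>UNIV. \<Sum>j\<in>UNIV. \<bar>A $ i $ j\<bar>"
  have "\<bar>matrix_pow A (Suc k) $ i $ j\<bar> \<le> (\<Sum>l\<in>UNIV. \<bar>A $ i $ l\<bar> * \<bar>matrix_pow A k $ l $ j\<bar>)"
    by (simp add: matrix_matrix_mult_def abs_mult[symmetric])
  also have "\<dots> \<le> (\<Sum>l\<in>UNIV. \<bar>A $ i $ l\<bar> * ?C ^ k)"
    by (intro sum_mono mult_left_mono Suc.IH) auto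
  also have "\<dots> = (\<Sum>l\<in>UNIV. \<bar>A $ i $ l\<bar>) * ?C ^ k"
    by (simp add: sum_distrib_right)
  also have "\<dots> \<le> ?C * ?C ^ k"
    by (intro mult_right_mono member_le_sum) (auto intro!: sum_nonneg zero_le_power)
  finally show ?case by simp
qed

lemma summable_matrix_exp: "summable (\<lambda>k. matrix_pow A k $ i $ j / fact k * t ^ k)"
proof (rule summable_comparison_test')
  let ?C = "\<Sum>i\<in>UNIV. \<Sum>j\<in>UNIV. \<bar>A $ i $ j\<bar>"
  show "summable (\<lambda>k. inverse (fact k) * (?C * \<bar>t\<bar>) ^ k)"
    by (rule summable_exp)
  show "norm (matrix_pow A k $ i $ j / fact k * t ^ k) \<le> inverse (fact k) * (?C * \<bar>t\<bar>) ^ k" for k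
    using mult_right_mono[OF matrix_pow_entry_bound[of A k i j], of "\<bar>t\<bar> ^ k / fact k"]
    by (simp add: abs_mult power_abs power_mult_distrib divide_inverse mult_ac)
qed

lemma matrix_exp_entry_sums:
  "(\<lambda>k. matrix_pow A k $ i $ j / fact k * t ^ k) sums (matrix_exp A t $ i $ j)"
  using summable_sums[OF summable_matrix_exp] by (simp only: matrix_exp_def vec_lambda_beta)

lemma matrix_exp_0 [simp]: "matrix_exp A 0 = mat 1"
proof -
  have "(\<Sum>k. matrix_pow A k $ i $ j / fact k * 0 ^ k) = mat 1 $ i $ j" for i j
    using powser_zero[of "\<lambda>k. matrix_pow A k $ i $ j / fact k"] by simp
  then show ?thesis
    by (simp add: matrix_exp_def vec_eq_iff)
qed

lemma has_vector_derivative_matrixI: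
  fixes f :: "real \<Rightarrow> real^'n^'m"
  assumes "\<And>i j. ((\<lambda>t. f t $ i $ j) has_real_derivative f' $ i $ j) (at t)"
  shows "(f has_vector_derivative f') (at t)"
  unfolding has_vector_derivative_def
proof (subst has_derivative_componentwise_within, rule ballI)
  fix b :: "real^'n^'m" assume "b \<in> Basis"
  then obtain i j where b: "b = axis i (axis j 1)"
    by (auto simp: Basis_vec_def)
  show "((\<lambda>x. f x \<bullet> b) has_derivative (\<lambda>x. (x *\<^sub>R f') \<bullet> b)) (at t)"
    using assms[of i j] unfolding b has_field_derivative_def
    by (simp add: inner_axis mult.commute[of _ "f' $ i $ j"])
qed

lemma DERIV_matrix_exp_entry:
  "((\<lambda>t. matrix_exp A t $ i $ j) has_real_derivative
     (\<Sum>k. matrix_pow A (Suc k) $ i $ j / fact k * t ^ k)) (at t)"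
proof -
  have "diffs (\<lambda>k. matrix_pow A k $ i $ j / fact k) = (\<lambda>k. matrix_pow A (Suc k) $ i $ j / fact k)"
    by (auto simp: diffs_def fun_eq_iff divide_simps)
  with termdiffs_strong_converges_everywhere[OF summable_matrix_exp, of A i j t]
  show ?thesis by (simp add: matrix_exp_def del: matrix_pow.simps)
qed

lemma matrix_exp_deriv_left:
  "(matrix_exp A has_vector_derivative (A ** matrix_exp A t)) (at t)"
proof (rule has_vector_derivative_matrixI)
  fix i j
  have "(\<lambda>k. \<Sum>l\<in>UNIV. A $ i $ l * (matrix_pow A k $ l $ j / fact k * t ^ k))
      sums (\<Sum>l\<in>UNIV. A $ i $ l * matrix_exp A t $ l $ j)"
    by (intro sums_sum sums_mult matrix_exp_entry_sums)
  moreover have "(\<Sum>l\<in>UNIV. A $ i $ l * (matrix_pow A k $ l $ j / fact k * t ^ k))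
      = matrix_pow A (Suc k) $ i $ j / fact k * t ^ k" for k
    unfolding matrix_pow.simps matrix_matrix_mult_def vec_lambda_beta sum_divide_distrib sum_distrib_right
    by (simp add: mult_ac)
  ultimately have "(\<Sum>k. matrix_pow A (Suc k) $ i $ j / fact k * t ^ k) = (A ** matrix_exp A t) $ i $ j"
    by (simp add: sums_iff matrix_matrix_mult_def)
  then show "((\<lambda>t. matrix_exp A t $ i $ j) has_real_derivative (A ** matrix_exp A t) $ i $ j) (at t)"
    using DERIV_matrix_exp_entry[of A i j t] by (simp only:)
qed

lemma matrix_exp_commute: "A ** matrix_exp A t = matrix_exp A t ** A"
proof -
  have "(A ** matrix_exp A t) $ i $ j = (matrix_exp A t ** A) $ i $ j" for i j
  proof -
    have left: "(\<lambda>k. \<Sum>l\<in>UNIV. A $ i $ l * (matrix_pow A k $ l $ j / fact k * t ^ k))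
        sums (\<Sum>l\<in>UNIV. A $ i $ l * matrix_exp A t $ l $ j)"
      by (intro sums_sum sums_mult matrix_exp_entry_sums)
    have right: "(\<lambda>k. \<Sum>l\<in>UNIV. (matrix_pow A k $ i $ l / fact k * t ^ k) * A $ l $ j)
        sums (\<Sum>l\<in>UNIV. matrix_exp A t $ i $ l * A $ l $ j)"
      by (intro sums_sum sums_mult2 matrix_exp_entry_sums)
    have terms: "(\<Sum>l\<in>UNIV. A $ i $ l * (matrix_pow A k $ l $ j / fact k * t ^ k))
        = (\<Sum>l\<in>UNIV. (matrix_pow A k $ i $ l / fact k * t ^ k) * A $ l $ j)" for k
    proof -
      have "(A ** matrix_pow A k) $ i $ j = (matrix_pow A k ** A) $ i $ j"
        using matrix_pow_Suc_right[of A k] by simp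
      then have "(\<Sum>l\<in>UNIV. A $ i $ l * matrix_pow A k $ l $ j) * (t ^ k / fact k)
          = (\<Sum>l\<in>UNIV. matrix_pow A k $ i $ l * A $ l $ j) * (t ^ k / fact k)"
        by (simp add: matrix_matrix_mult_def)
      then show ?thesis
        unfolding sum_distrib_right by (simp add: mult_ac)
    qed
    show ?thesis
      using sums_unique2[OF left[unfolded terms] right] by (simp add: matrix_matrix_mult_def)
  qed
  then show ?thesis by (simp add: vec_eq_iff)
qed

lemma continuous_on_matrix_exp: "continuous_on S (matrix_exp A)"
  by (rule continuous_at_imp_continuous_on)
    (blast intro: has_vector_derivative_continuous[OF matrix_exp_deriv_left])

lemma continuous_on_matrix_exp_compose [continuous_intros]:
  "continuous_on S f \<Longrightarrow> continuous_on S (\<lambda>x. matrix_exp A (f x))"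
  by (rule continuous_on_compose2[OF continuous_on_matrix_exp _ subset_UNIV])

lemma continuous_on_matrix_vector_mult [continuous_intros]:
  fixes f :: "'a::topological_space \<Rightarrow> real^'n^'m"
  shows "continuous_on S f \<Longrightarrow> continuous_on S g \<Longrightarrow> continuous_on S (\<lambda>x. f x *v g x)"
  by (rule bounded_bilinear.continuous_on[OF bounded_bilinear_matrix_vector_mult])

lemma matrix_exp_minus_deriv:
  "((\<lambda>t. matrix_exp A (c - t)) has_vector_derivative - (A ** matrix_exp A (c - t))) (at t)"
proof -
  have "((\<lambda>t. c - t) has_vector_derivative - 1) (at t)"
    by (auto intro!: derivative_eq_intros)
  from vector_diff_chain_at[OF this matrix_exp_deriv_left]
  show ?thesis by (simp add: o_def)
qed

text \<open>
  The function \<open>r \<mapsto> e\<^bsup>(s+t-r)A\<^esup> e\<^bsup>rA\<^esup> x\<close> has derivative zero because \<open>A\<close> commutes with its exponential;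
  its values at \<open>t\<close> and at \<open>0\<close> are the two sides.
\<close>

lemma matrix_exp_add_vec: "matrix_exp A s *v (matrix_exp A t *v x) = matrix_exp A (s + t) *v x"
proof -
  have "((\<lambda>r. matrix_exp A (s + t - r) *v (matrix_exp A r *v x)) has_vector_derivative 0) (at r within UNIV)" for r
  proof -
    have "((\<lambda>r. matrix_exp A r *v x) has_vector_derivative (A ** matrix_exp A r) *v x) (at r)"
      using bounded_linear.has_vector_derivative[OF
          bounded_bilinear.bounded_linear_left[OF bounded_bilinear_matrix_vector_mult] matrix_exp_deriv_left] .
    note bounded_bilinear.has_vector_derivative[OF bounded_bilinear_matrix_vector_mult
        matrix_exp_minus_deriv this, of A "s + t"]
    moreover have "matrix_exp A (s + t - r) *v ((A ** matrix_exp A r) *v x)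
        + (- (A ** matrix_exp A (s + t - r))) *v (matrix_exp A r *v x) = 0"
      unfolding minus_matrix_vector_mult matrix_exp_commute[of A "s + t - r"]
      by (simp add: matrix_vector_mul_assoc matrix_mul_assoc)
    ultimately show ?thesis by simp
  qed
  then obtain c where "\<And>r. matrix_exp A (s + t - r) *v (matrix_exp A r *v x) = c"
    using has_vector_derivative_zero_constant[of UNIV
        "\<lambda>r. matrix_exp A (s + t - r) *v (matrix_exp A r *v x)"] by auto
  from this[of t] this[of 0] show ?thesis by simp
qed

lemma matrix_exp_add: "matrix_exp A s ** matrix_exp A t = matrix_exp A (s + t)"
  by (simp add: matrix_eq matrix_vector_mul_assoc[symmetric] matrix_exp_add_vec)

lemma matrix_exp_cancel [simp]: "matrix_exp A (- t) *v (matrix_exp A t *v x) = x"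
  "matrix_exp A t *v (matrix_exp A (- t) *v x) = x"
  by (simp_all add: matrix_exp_add_vec)

section \<open>Variation of constants\<close>

lemma absolutely_integrable_matrix_input:
  fixes B :: "'q \<Rightarrow> 'p::finite \<Rightarrow> real^'n" and M :: "real \<Rightarrow> real^'n^'n"
  assumes u: "\<And>s. u s absolutely_integrable_on {0..T}"
    and M: "continuous_on {0..T} M"
  shows "(\<lambda>r. M r *v (\<Sum>s\<in>UNIV. u s r *\<^sub>R B i s)) absolutely_integrable_on {0..T}"
proof (rule absolutely_integrable_bounded_measurable_product[where h = "(*v)"])
  show "bilinear ((*v) :: real^'n^'n \<Rightarrow> _)"
    using bounded_bilinear_matrix_vector_mult by (simp add: bilinear_conv_bounded_bilinear)
  show "M \<in> borel_measurable (lebesgue_on {0..T})"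
    by (rule continuous_imp_measurable_on_sets_lebesgue[OF M]) auto
  show "bounded (M ` {0..T})"
    using compact_continuous_image[OF M] by (simp add: compact_imp_bounded)
  show "(\<lambda>r. \<Sum>s\<in>UNIV. u s r *\<^sub>R B i s) absolutely_integrable_on {0..T}"
  proof (rule absolutely_integrable_sum)
    show "(\<lambda>r. u s r *\<^sub>R B i s) absolutely_integrable_on {0..T}" for s
      using absolutely_integrable_linear[OF u bounded_linear_scaleR_left[of "B i s"]]
      by (simp add: o_def)
  qed auto
qed auto

text \<open>
  The effect of the input on the states at time \<open>T\<close>, transported back to time \<open>0\<close> by the free motion.
\<close>

definition displacement ::
  "real^'n^'n \<Rightarrow> ('q \<Rightarrow> 'p::finite \<Rightarrow> real^'n) \<Rightarrow> real \<Rightarrow> ('p \<Rightarrow> real \<Rightarrow> real) \<Rightarrow> real^'n^'q" where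
  "displacement A B T u =
    (\<chi> i. integral {0..T} (\<lambda>r. matrix_exp A (- r) *v (\<Sum>s\<in>UNIV. u s r *\<^sub>R B i s)))"

lemma displacement_has_integral:
  assumes "\<And>s. u s absolutely_integrable_on {0..T}"
  shows "((\<lambda>r. matrix_exp A (- r) *v (\<Sum>s\<in>UNIV. u s r *\<^sub>R B i s)) has_integral
    displacement A B T u $ i) {0..T}"
proof -
  have "continuous_on {0..T} (\<lambda>r. matrix_exp A (- r))"
    by (intro continuous_intros)
  from absolutely_integrable_matrix_input[OF assms this]
  show ?thesis
    unfolding displacement_def vec_lambda_beta
    by (intro integrable_integral set_lebesgue_integral_eq_integral(1))
qed

text \<open>
  In \<open>e\<^bsup>-rA\<^esup> x\<^sub>i(r)\<close> the drift \<open>A x\<^sub>i\<close> cancels against the derivative of the exponential, which leaves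
  the input term alone.
\<close>

lemma array_solution_endpoint:
  fixes B :: "'q::finite \<Rightarrow> 'p::finite \<Rightarrow> real^'n"
  assumes sol: "array_solution A B T u x0 x"
    and u: "\<And>s. u s absolutely_integrable_on {0..T}" and T: "0 \<le> T"
  shows "x i T = matrix_exp A T *v (x0 i + displacement A B T u $ i)"
proof -
  define b where "b = (\<lambda>r. \<Sum>s\<in>UNIV. u s r *\<^sub>R B i s)"
  have I: "((\<lambda>r. A *v x i r + b r) has_integral (x i t - x0 i)) {0..t}" if "t \<in> {0..T}" for t
    using sol that by (simp add: array_solution_def b_def)
  have x_0: "x i 0 = x0 i"
    using I[of 0] T by (auto simp: has_integral_iff)
  have x_eq: "x i t = x0 i + integral {0..t} (\<lambda>r. A *v x i r + b r)" if "t \<in> {0..T}" for t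
    using I[OF that] by (simp add: integral_unique)
  have "continuous_on {0..T} (\<lambda>t. x0 i + integral {0..t} (\<lambda>r. A *v x i r + b r))"
    using I[of T] T by (intro continuous_intros indefinite_integral_continuous_1) auto
  then have contx: "continuous_on {0..T} (x i)"
    by (rule continuous_on_eq) (rule x_eq[symmetric])
  have b_int: "b absolutely_integrable_on {0..T}"
    using absolutely_integrable_matrix_input[OF u, where M = "\<lambda>_. mat 1" and B = B and i = i]
    by (simp add: b_def)
  have g_int: "(\<lambda>r. A *v x i r + b r) absolutely_integrable_on {0..T}"
    by (intro set_integral_add(1) b_int absolutely_integrable_continuous_real continuous_intros contx)
  have "((\<lambda>r. (- (A ** matrix_exp A (0 - r))) *v x i r + matrix_exp A (0 - r) *v (A *v x i r + b r))
      has_integral (matrix_exp A (0 - T) *v x i T - matrix_exp A (0 - 0) *v x i 0)) {0..T}"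
  proof (rule indefinite_integral_product_rule[OF bounded_bilinear_matrix_vector_mult _ _ g_int _ T])
    show "((\<lambda>r. matrix_exp A (0 - r)) has_vector_derivative - (A ** matrix_exp A (0 - t))) (at t within {0..T})" for t
      by (rule has_vector_derivative_at_within[OF matrix_exp_minus_deriv])
    show "continuous_on {0..T} (\<lambda>r. - (A ** matrix_exp A (0 - r)))"
      unfolding matrix_matrix_mult_def by (intro continuous_intros)
    show "((\<lambda>r. A *v x i r + b r) has_integral (x i t - x i 0)) {0..t}" if "t \<in> {0..T}" for t
      using I[OF that] x_0 by simp
  qed
  moreover have "(- (A ** matrix_exp A (0 - r))) *v x i r + matrix_exp A (0 - r) *v (A *v x i r + b r)
      = matrix_exp A (- r) *v b r" for r
    unfolding minus_matrix_vector_mult matrix_exp_commute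
    by (simp add: matrix_vector_right_distrib matrix_vector_mul_assoc)
  ultimately have "((\<lambda>r. matrix_exp A (- r) *v b r) has_integral (matrix_exp A (- T) *v x i T - x0 i)) {0..T}"
    by (simp add: x_0)
  from has_integral_unique[OF
      displacement_has_integral[where u = u and T = T and A = A and B = B and i = i, OF u]
      this[unfolded b_def]]
  have "displacement A B T u $ i = matrix_exp A (- T) *v x i T - x0 i" .
  then show ?thesis by simp
qed

text \<open>
  The solution is the one that the variation of constants formula prescribes.
\<close>

lemma array_solution_exists:
  fixes B :: "'q::finite \<Rightarrow> 'p::finite \<Rightarrow> real^'n"
  assumes u: "\<And>s. u s absolutely_integrable_on {0..T}" and T: "0 \<le> T"
  shows "\<exists>x. array_solution A B T u x0 x"
proof
  define b where "b = (\<lambda>i r. \<Sum>s\<in>UNIV. u s r *\<^sub>R B i s)"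
  define f where "f = (\<lambda>i t. x0 i + integral {0..t} (\<lambda>r. matrix_exp A (- r) *v b i r))"
  show "array_solution A B T u x0 (\<lambda>i t. matrix_exp A t *v f i t)"
    unfolding array_solution_def
  proof (intro allI ballI)
    fix i t assume t: "t \<in> {0..T}"
    have f_0: "f i 0 = x0 i" by (simp add: f_def)
    have g_int: "(\<lambda>r. matrix_exp A (- r) *v b i r) absolutely_integrable_on {0..a}" if "a \<in> {0..T}" for a
    proof -
      have "u s absolutely_integrable_on {0..a}" for s
        by (rule absolutely_integrable_on_subinterval[OF u]) (use that in auto)
      then show ?thesis
        unfolding b_def by (rule absolutely_integrable_matrix_input) (intro continuous_intros)
    qed
    have "((\<lambda>r. (A ** matrix_exp A r) *v f i r + matrix_exp A r *v (matrix_exp A (- r) *v b i r))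
      has_integral (matrix_exp A t *v f i t - matrix_exp A 0 *v f i 0)) {0..t}"
    proof (rule indefinite_integral_product_rule[OF bounded_bilinear_matrix_vector_mult _ _ g_int[OF t]])
      show "(matrix_exp A has_vector_derivative A ** matrix_exp A r) (at r within {0..t})" for r
        by (rule has_vector_derivative_at_within[OF matrix_exp_deriv_left])
      show "continuous_on {0..t} (\<lambda>r. A ** matrix_exp A r)"
        unfolding matrix_matrix_mult_def by (intro continuous_intros)
      show "((\<lambda>r. matrix_exp A (- r) *v b i r) has_integral (f i a - f i 0)) {0..a}" if "a \<in> {0..t}" for a
        using that t g_int[of a] set_lebesgue_integral_eq_integral(1)
        by (auto simp: f_0 f_def intro!: integrable_integral)
    qed (use t in auto)
    then show "((\<lambda>r. A *v (matrix_exp A r *v f i r) + (\<Sum>s\<in>UNIV. u s r *\<^sub>R B i s)) has_integral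
        matrix_exp A t *v f i t - x0 i) {0..t}"
      by (simp add: f_0 b_def matrix_vector_mul_assoc[symmetric])
  qed
qed

section \<open>Displacements attainable by nonnegative inputs\<close>

definition relative_space :: "(real^'n^'q) set" where
  "relative_space = {y. (\<Sum>i\<in>UNIV. y $ i) = 0}"

definition displacements ::
  "real^'n^'n \<Rightarrow> ('q \<Rightarrow> 'p::finite \<Rightarrow> real^'n) \<Rightarrow> real set \<Rightarrow> (real^'n^'q) set" where
  "displacements A B U = {displacement A B T u | T u. 0 < T \<and>
    (\<forall>s. u s absolutely_integrable_on {0..T}) \<and> (\<forall>s. \<forall>t\<in>{0..T}. u s t \<in> U)}"

lemma displacementsI:
  "0 < T \<Longrightarrow> (\<And>s. u s absolutely_integrable_on {0..T}) \<Longrightarrow>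
    (\<And>s t. t \<in> {0..T} \<Longrightarrow> u s t \<in> U) \<Longrightarrow> displacement A B T u \<in> displacements A B U"
  unfolding displacements_def by blast

lemma displacement_in_relative_space:
  fixes B :: "'q::finite \<Rightarrow> 'p::finite \<Rightarrow> real^'n"
  assumes rel: "relative_actuation B" and u: "\<And>s. u s absolutely_integrable_on {0..T}"
  shows "displacement A B T u \<in> relative_space"
proof -
  have "((\<lambda>r. \<Sum>i\<in>UNIV. matrix_exp A (- r) *v (\<Sum>s\<in>UNIV. u s r *\<^sub>R B i s)) has_integral
      (\<Sum>i\<in>UNIV. displacement A B T u $ i)) {0..T}"
    by (intro has_integral_sum displacement_has_integral u) auto
  moreover have "(\<Sum>i\<in>UNIV. matrix_exp A (- r) *v (\<Sum>s\<in>UNIV. u s r *\<^sub>R B i s)) = 0" for r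
  proof -
    have "(\<Sum>i\<in>UNIV. \<Sum>s\<in>UNIV. u s r *\<^sub>R B i s) = (\<Sum>s\<in>UNIV. u s r *\<^sub>R (\<Sum>i\<in>UNIV. B i s))"
      by (subst sum.swap) (simp add: scaleR_sum_right)
    also have "\<dots> = 0" using rel by (simp add: relative_actuation_def)
    finally show ?thesis
      by (simp add: linear_sum[OF matrix_vector_mul_linear, symmetric])
  qed
  ultimately show ?thesis
    by (simp add: relative_space_def has_integral_iff)
qed

lemma displacements_subset: 
  fixes B :: "'q::finite \<Rightarrow> 'p::finite \<Rightarrow> real^'n"
  shows "relative_actuation B \<Longrightarrow> displacements A B U \<subseteq> relative_space"
  by (auto simp: displacements_def intro: displacement_in_relative_space)

text \<open>
  The invertible matrix \<open>e\<^sup>T\<^sup>A\<close> can be dropped from the final states, so synchronization means that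
  \<open>x\<^sub>i(0) + y\<^sub>i\<close> is the same for all \<open>i\<close>. From left to right, the initial states \<open>-w\<^sub>i\<close>
  force \<open>y = w\<close>, since both have zero sum. From right to left, the displacement is chosen to move every
  initial state to the average of the initial states.

  The set \<open>U\<close> of admissible input values covers signed and nonnegative inputs at once.
\<close>

lemma synchronizable_iff_displacements:
  fixes A :: "real^'n^'n" and B :: "'q::finite \<Rightarrow> 'p::finite \<Rightarrow> real^'n"
  assumes rel: "relative_actuation B"
  shows "(\<forall>x0. \<exists>T>0. \<exists>u x. (\<forall>s. u s absolutely_integrable_on {0..T}) \<and>
      (\<forall>s. \<forall>t\<in>{0..T}. u s t \<in> U) \<and> array_solution A B T u x0 x \<and> (\<forall>i j. x i T = x j T))
    \<longleftrightarrow> relative_space \<subseteq> displacements A B U" (is "?sync \<longleftrightarrow> _")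
proof
  assume ?sync
  show "relative_space \<subseteq> displacements A B U"
  proof
    fix w :: "real^'n^'q" assume w: "w \<in> relative_space"
    from \<open>?sync\<close> obtain T u x where T: "0 < T" and u: "\<And>s. u s absolutely_integrable_on {0..T}"
      and U: "\<forall>s. \<forall>t\<in>{0..T}. u s t \<in> U" and sol: "array_solution A B T u (\<lambda>i. - w $ i) x"
      and eq: "\<And>i j. x i T = x j T" by metis
    define m where "m = displacement A B T u"
    define c where "c = matrix_exp A (- T) *v x undefined T"
    have "m $ i - w $ i = c" for i
      using array_solution_endpoint[OF sol u less_imp_le[OF T], of i] eq[of i undefined]
      by (simp add: m_def c_def)
    then have mw: "m $ i = c + w $ i" for i by (metis diff_add_cancel)
    have "(\<Sum>i\<in>UNIV. m $ i) = (\<Sum>i::'q\<in>UNIV. c)"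
      using w by (simp add: mw sum.distrib relative_space_def)
    then have "c = 0"
      using displacement_in_relative_space[OF rel u, of A]
      by (simp add: m_def relative_space_def sum_constant_scaleR del: sum_constant)
    with mw have "w = m" by (simp add: vec_eq_iff)
    with T u U show "w \<in> displacements A B U"
      by (auto simp: displacements_def m_def)
  qed
next
  assume sub: "relative_space \<subseteq> displacements A B U"
  show ?sync
  proof
    fix x0 :: "'q \<Rightarrow> real^'n"
    define a where "a = (\<Sum>i\<in>UNIV. x0 i) /\<^sub>R CARD('q)"
    have "(\<Sum>i::'q\<in>UNIV. a) = (\<Sum>i\<in>UNIV. x0 i)"
      by (simp add: a_def sum_constant_scaleR del: sum_constant)
    then have "(\<chi> i. a - x0 i) \<in> relative_space"
      by (simp add: relative_space_def sum_subtractf)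
    with sub obtain T u where T: "0 < T" and u: "\<And>s. u s absolutely_integrable_on {0..T}"
      and U: "\<forall>s. \<forall>t\<in>{0..T}. u s t \<in> U" and d: "displacement A B T u = (\<chi> i. a - x0 i)"
      by (force simp: displacements_def)
    obtain x where x: "array_solution A B T u x0 x"
      using array_solution_exists[where u = u, OF u less_imp_le[OF T]] by blast
    have "x i T = matrix_exp A T *v a" for i
      using array_solution_endpoint[OF x u less_imp_le[OF T], of i] by (simp add: d)
    with T u U x show "\<exists>T>0. \<exists>u x. (\<forall>s. u s absolutely_integrable_on {0..T}) \<and>
      (\<forall>s. \<forall>t\<in>{0..T}. u s t \<in> U) \<and> array_solution A B T u x0 x \<and> (\<forall>i j. x i T = x j T)"
      by metis
  qed
qed

lemma controllable_iff_displacements: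
  fixes A :: "real^'n^'n" and B :: "'q::finite \<Rightarrow> 'p::finite \<Rightarrow> real^'n"
  assumes "relative_actuation B"
  shows "controllable A B \<longleftrightarrow> relative_space \<subseteq> displacements A B UNIV"
  using synchronizable_iff_displacements[OF assms, of UNIV A] by (simp add: controllable_def)

lemma positively_controllable_iff_displacements:
  fixes A :: "real^'n^'n" and B :: "'q::finite \<Rightarrow> 'p::finite \<Rightarrow> real^'n"
  assumes "relative_actuation B"
  shows "positively_controllable A B \<longleftrightarrow> relative_space \<subseteq> displacements A B {0..}"
  using synchronizable_iff_displacements[OF assms, of "{0..}" A] by (simp add: positively_controllable_def)

lemma displacement_linear:
  fixes B :: "'q::finite \<Rightarrow> 'p::finite \<Rightarrow> real^'n"
  assumes u: "\<And>s. u s absolutely_integrable_on {0..T}" and v: "\<And>s. v s absolutely_integrable_on {0..T}"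
  shows "displacement A B T (\<lambda>s r. a * u s r + b * v s r)
    = a *\<^sub>R displacement A B T u + b *\<^sub>R displacement A B T v"
proof -
  have uv: "(\<lambda>r. a * u s r + b * v s r) absolutely_integrable_on {0..T}" for s
    by (intro set_integral_add(1) set_integrable_mult_right u v)
  have "displacement A B T (\<lambda>s r. a * u s r + b * v s r) $ i
    = a *\<^sub>R displacement A B T u $ i + b *\<^sub>R displacement A B T v $ i" for i
  proof -
    have "((\<lambda>r. a *\<^sub>R (matrix_exp A (- r) *v (\<Sum>s\<in>UNIV. u s r *\<^sub>R B i s))
        + b *\<^sub>R (matrix_exp A (- r) *v (\<Sum>s\<in>UNIV. v s r *\<^sub>R B i s))) has_integral
        a *\<^sub>R displacement A B T u $ i + b *\<^sub>R displacement A B T v $ i) {0..T}"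
      by (intro has_integral_add has_integral_cmul displacement_has_integral u v)
    moreover have "a *\<^sub>R (matrix_exp A (- r) *v (\<Sum>s\<in>UNIV. u s r *\<^sub>R B i s))
        + b *\<^sub>R (matrix_exp A (- r) *v (\<Sum>s\<in>UNIV. v s r *\<^sub>R B i s))
      = matrix_exp A (- r) *v (\<Sum>s\<in>UNIV. (a * u s r + b * v s r) *\<^sub>R B i s)" for r
      by (simp add: scaleR_left_distrib sum.distrib matrix_vector_right_distrib
          matrix_vector_mult_scaleR[symmetric] scaleR_sum_right)
    ultimately show ?thesis
      using displacement_has_integral[where u = "\<lambda>s r. a * u s r + b * v s r" and B = B and A = A and i = i, OF uv]
      by (simp add: has_integral_iff)
  qed
  then show ?thesis by (simp add: vec_eq_iff)
qed

text \<open>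
  Displacements refer back to time \<open>0\<close>, so an input that is switched off after \<open>T\<close> has the same
  displacement over any longer horizon. This brings two inputs to a common horizon.
\<close>

lemma extend_control_by_zero:
  fixes B :: "'q::finite \<Rightarrow> 'p::finite \<Rightarrow> real^'n"
  assumes u: "\<And>s. u s absolutely_integrable_on {0..T}" and T: "T \<le> T'"
  defines "u' \<equiv> (\<lambda>s r. if r \<in> {0..T} then u s r else 0)"
  shows "u' s absolutely_integrable_on {0..T'}" "displacement A B T' u' = displacement A B T u"
proof -
  have sub: "{0..T} \<subseteq> {0..T'}" using T by auto
  have "u' s absolutely_integrable_on UNIV"
    unfolding u'_def using u by (simp only: absolutely_integrable_restrict_UNIV)
  then show "u' s absolutely_integrable_on {0..T'}"
    by (rule set_integrable_subset) auto
  have "displacement A B T' u' $ i = displacement A B T u $ i" for i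
  proof -
    have "((\<lambda>r. matrix_exp A (- r) *v (\<Sum>s\<in>UNIV. u s r *\<^sub>R B i s))
        has_integral displacement A B T u $ i) (cbox 0 T)"
      using displacement_has_integral[where u = u, OF u] by simp
    from has_integral_restrict_closed_subinterval[OF this, of 0 T']
    have "((\<lambda>r. if r \<in> {0..T} then matrix_exp A (- r) *v (\<Sum>s\<in>UNIV. u s r *\<^sub>R B i s) else 0)
        has_integral displacement A B T u $ i) {0..T'}"
      using sub by simp
    then have "((\<lambda>r. matrix_exp A (- r) *v (\<Sum>s\<in>UNIV. u' s r *\<^sub>R B i s))
        has_integral displacement A B T u $ i) {0..T'}"
      by (rule has_integral_eq[rotated]) (simp add: u'_def)
    then show ?thesis
      unfolding displacement_def vec_lambda_beta by (rule integral_unique)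
  qed
  then show "displacement A B T' u' = displacement A B T u"
    by (simp add: vec_eq_iff)
qed

lemma displacements_nonneg_cone:
  fixes B :: "'q::finite \<Rightarrow> 'p::finite \<Rightarrow> real^'n"
  assumes y: "y \<in> displacements A B {0..}" and z: "z \<in> displacements A B {0..}" and ab: "0 \<le> a" "0 \<le> b"
  shows "a *\<^sub>R y + b *\<^sub>R z \<in> displacements A B {0..}"
proof -
  from y z obtain T u T' v where T: "0 < T" "0 < T'"
    and u: "\<And>s. u s absolutely_integrable_on {0..T}" "\<And>s t. t \<in> {0..T} \<Longrightarrow> 0 \<le> u s t" "y = displacement A B T u"
    and v: "\<And>s. v s absolutely_integrable_on {0..T'}" "\<And>s t. t \<in> {0..T'} \<Longrightarrow> 0 \<le> v s t" "z = displacement A B T' v"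
    unfolding displacements_def by fastforce
  define S where "S = max T T'"
  have S: "T \<le> S" "T' \<le> S" "0 < S" using T by (auto simp: S_def)
  define u' where "u' = (\<lambda>s r. if r \<in> {0..T} then u s r else 0)"
  define v' where "v' = (\<lambda>s r. if r \<in> {0..T'} then v s r else 0)"
  have u': "u' s absolutely_integrable_on {0..S}" "displacement A B S u' = y" for s
    using extend_control_by_zero[where u = u, OF u(1) S(1)] u(3) by (simp_all add: u'_def)
  have v': "v' s absolutely_integrable_on {0..S}" "displacement A B S v' = z" for s
    using extend_control_by_zero[where u = v, OF v(1) S(2)] v(3) by (simp_all add: v'_def)
  have nonneg: "0 \<le> a * u' s r + b * v' s r" for s r
    using u(2) v(2) ab by (simp add: u'_def v'_def)
  have "(\<lambda>r. a * u' s r + b * v' s r) absolutely_integrable_on {0..S}" for s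
    by (intro set_integral_add(1) set_integrable_mult_right u' v')
  moreover have "displacement A B S (\<lambda>s r. a * u' s r + b * v' s r) = a *\<^sub>R y + b *\<^sub>R z"
    using displacement_linear[where u = u' and v = v', OF u'(1) v'(1), of A B a b] u' v' by simp
  ultimately show ?thesis
    using S nonneg unfolding displacements_def
    by (intro CollectI exI[of _ S] exI[of _ "\<lambda>s r. a * u' s r + b * v' s r"]) simp
qed

lemma zero_in_displacements:
  fixes B :: "'q::finite \<Rightarrow> 'p::finite \<Rightarrow> real^'n"
  shows "0 \<in> displacements A B {0..}"
proof -
  have "displacement A B 1 (\<lambda>s r. 0) = 0"
    by (simp add: displacement_def vec_eq_iff)
  then show ?thesis
    unfolding displacements_def by (intro CollectI exI[of _ 1] exI[of _ "\<lambda>s r. 0"]) auto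
qed

text \<open>
  An input is the difference of its positive and negative parts.
\<close>

lemma displacements_eq_difference:
  fixes B :: "'q::finite \<Rightarrow> 'p::finite \<Rightarrow> real^'n"
  assumes "y \<in> displacements A B UNIV"
  obtains y1 y2 where "y1 \<in> displacements A B {0..}" "y2 \<in> displacements A B {0..}" "y = y1 - y2"
proof -
  from assms obtain T u where T: "0 < T" and u: "\<And>s. u s absolutely_integrable_on {0..T}"
    and y: "y = displacement A B T u"
    unfolding displacements_def by auto
  define p where "p = (\<lambda>s r. max 0 (u s r))"
  define n where "n = (\<lambda>s r. max 0 (- u s r))"
  have p: "p s absolutely_integrable_on {0..T}" for s
    unfolding p_def by (intro absolutely_integrable_max_1 u) auto
  have n: "n s absolutely_integrable_on {0..T}" for s
    using set_integrable_mult_right[of "- 1", OF u[of s]]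
    unfolding n_def by (intro absolutely_integrable_max_1) auto
  have "u = (\<lambda>s r. 1 * p s r + (- 1) * n s r)"
    by (auto simp: p_def n_def fun_eq_iff max_def)
  then have "y = displacement A B T p - displacement A B T n"
    using displacement_linear[where u = p and v = n, OF p n, of A B 1 "- 1"] y by simp
  moreover have "displacement A B T p \<in> displacements A B {0..}" "displacement A B T n \<in> displacements A B {0..}"
    using T p n by (auto intro!: displacementsI simp: p_def n_def)
  ultimately show thesis using that by blast
qed

section \<open>Eigenvectors of a flow preserving a compact convex set\<close>

text \<open>
  For a fixed time \<open>h\<close>, Brouwer's theorem gives a fixed point of the normalized map
  \<open>x \<mapsto> \<Phi> h x / (e \<bullet> \<Phi> h x)\<close> on \<open>\<Delta>\<close>, that is, an eigenvector of \<open>\<Phi> h\<close>. An eigenvector for the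
  time \<open>2\<^bsup>-k\<^esup>\<close> is one for all its multiples, in particular for the times \<open>2\<^bsup>-m\<^esup>\<close> with \<open>m \<le> k\<close>. A limit
  point of these eigenvectors as \<open>k\<close> grows is therefore an eigenvector for all times \<open>2\<^bsup>-m\<^esup>\<close>, and
  differentiating along \<open>m \<rightarrow> \<infinity>\<close> makes it an eigenvector of the generator \<open>L\<close>.
\<close>

lemma eigenvector_of_generator:
  fixes \<Phi> :: "real \<Rightarrow> 'a::euclidean_space \<Rightarrow> 'a"
  assumes \<Delta>: "compact \<Delta>" "convex \<Delta>" "\<Delta> \<noteq> {}"
    and e: "\<And>x. x \<in> \<Delta> \<Longrightarrow> e \<bullet> x = 1"
    and lin: "\<And>h. linear (\<Phi> h)"
    and semigroup: "\<And>s t x. \<Phi> s (\<Phi> t x) = \<Phi> (s + t) x"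
    and pos: "\<And>h x. 0 \<le> h \<Longrightarrow> x \<in> \<Delta> \<Longrightarrow> 0 < e \<bullet> \<Phi> h x"
    and inv: "\<And>h x. 0 \<le> h \<Longrightarrow> x \<in> \<Delta> \<Longrightarrow> \<Phi> h x /\<^sub>R (e \<bullet> \<Phi> h x) \<in> \<Delta>"
    and \<Phi>_0: "\<And>x. \<Phi> 0 x = x"
    and deriv: "\<And>x. ((\<lambda>h. \<Phi> h x) has_vector_derivative L x) (at 0)"
  obtains x c where "x \<in> \<Delta>" "L x = c *\<^sub>R x"
proof -
  define eig where "eig h x \<longleftrightarrow> \<Phi> h x = (e \<bullet> \<Phi> h x) *\<^sub>R x" for h x
  have cont: "continuous_on S (\<Phi> h)" for S h
    by (simp add: lin linear_continuous_on linear_conv_bounded_linear[symmetric])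
  have "\<exists>x\<in>\<Delta>. eig h x" if h: "0 \<le> h" for h
  proof -
    have "continuous_on \<Delta> (\<lambda>x. \<Phi> h x /\<^sub>R (e \<bullet> \<Phi> h x))"
      using pos[OF h] by (intro continuous_intros cont) force
    then obtain x where x: "x \<in> \<Delta>" "\<Phi> h x /\<^sub>R (e \<bullet> \<Phi> h x) = x"
      using brouwer[OF \<Delta>, of "\<lambda>x. \<Phi> h x /\<^sub>R (e \<bullet> \<Phi> h x)"] inv[OF h] by blast
    have "\<Phi> h x = (e \<bullet> \<Phi> h x) *\<^sub>R (\<Phi> h x /\<^sub>R (e \<bullet> \<Phi> h x))"
      using pos[OF h x(1)] by simp
    with x show ?thesis unfolding eig_def by auto
  qed
  then have "\<exists>X. \<forall>k::nat. X k \<in> \<Delta> \<and> eig (1 / 2 ^ k) (X k)"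
    by (intro choice) (metis zero_le_divide_1_iff zero_le_numeral zero_le_power)
  then obtain X where X: "\<And>k. X k \<in> \<Delta>" "\<And>k. eig (1 / 2 ^ k) (X k)" by blast
  obtain x r where x: "x \<in> \<Delta>" "strict_mono r" "(X \<circ> r) \<longlonglongrightarrow> x"
    using \<Delta>(1) X(1) unfolding compact_def by metis
  have eig_mult: "eig (real n * h) y" if "y \<in> \<Delta>" "eig h y" for n h y
  proof (induction n)
    case 0
    then show ?case using e[OF that(1)] by (simp add: eig_def \<Phi>_0)
  next
    case (Suc n)
    have "\<Phi> (real (Suc n) * h) y = \<Phi> h (\<Phi> (real n * h) y)"
      by (simp add: semigroup algebra_simps)
    also have "\<dots> = \<Phi> h ((e \<bullet> \<Phi> (real n * h) y) *\<^sub>R y)"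
      using Suc by (simp add: eig_def)
    also have "\<dots> = (e \<bullet> \<Phi> (real n * h) y) *\<^sub>R (e \<bullet> \<Phi> h y) *\<^sub>R y"
      using that(2) by (simp add: linear_scale[OF lin] eig_def)
    finally have *: "\<Phi> (real (Suc n) * h) y = (e \<bullet> \<Phi> (real n * h) y) *\<^sub>R (e \<bullet> \<Phi> h y) *\<^sub>R y" .
    show ?case
      unfolding eig_def * using e[OF that(1)] by simp
  qed
  have dyadic: "eig (1 / 2 ^ m) x" for m
  proof -
    have "eig (1 / 2 ^ m) (X (r k))" if "m \<le> k" for k
    proof -
      have "m \<le> r k" using that seq_suble[OF x(2), of k] by simp
      then have "1 / 2 ^ m = real (2 ^ (r k - m)) * (1 / 2 ^ r k)"
        using power_add[of "2::real" "r k - m" m] by (simp add: field_simps)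
      then show ?thesis using eig_mult[OF X, of "2 ^ (r k - m)" "r k"] by simp
    qed
    then have ev: "\<forall>\<^sub>F k in sequentially. (e \<bullet> \<Phi> (1 / 2 ^ m) ((X \<circ> r) k)) *\<^sub>R (X \<circ> r) k = \<Phi> (1 / 2 ^ m) ((X \<circ> r) k)"
      unfolding eventually_sequentially eig_def by (metis comp_apply)
    have lim: "(\<lambda>k. \<Phi> (1 / 2 ^ m) ((X \<circ> r) k)) \<longlonglongrightarrow> \<Phi> (1 / 2 ^ m) x"
      using continuous_on_tendsto_compose[OF cont[of UNIV] x(3)] by simp
    then have "(\<lambda>k. (e \<bullet> \<Phi> (1 / 2 ^ m) ((X \<circ> r) k)) *\<^sub>R (X \<circ> r) k) \<longlonglongrightarrow> (e \<bullet> \<Phi> (1 / 2 ^ m) x) *\<^sub>R x"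
      by (intro tendsto_intros x(3))
    from Lim_transform_eventually[OF this ev] lim show ?thesis
      unfolding eig_def by (rule LIMSEQ_unique[rotated])
  qed
  define D where "D = (\<lambda>h. (\<Phi> h x - x) /\<^sub>R h)"
  have "(D \<longlongrightarrow> L x) (at 0)"
  proof (rule LIM_zero_cancel, rule tendsto_norm_zero_cancel)
    have "((\<lambda>h. norm (\<Phi> h x - x - h *\<^sub>R L x) / norm h) \<longlongrightarrow> 0) (at 0)"
      using deriv[of x] by (simp add: has_vector_derivative_def has_derivative_at \<Phi>_0)
    moreover have "norm (\<Phi> h x - x - h *\<^sub>R L x) / norm h = norm (D h - L x)" if "h \<noteq> 0" for h
    proof -
      have "D h - L x = (\<Phi> h x - x - h *\<^sub>R L x) /\<^sub>R h"
        using that by (simp add: D_def scaleR_diff_right)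
      then show ?thesis by (simp add: divide_inverse_commute)
    qed
    ultimately show "((\<lambda>h. norm (D h - L x)) \<longlongrightarrow> 0) (at 0)"
      by (elim Lim_transform_eventually) (simp add: eventually_at_filter)
  qed
  moreover have "filterlim (\<lambda>m. 1 / 2 ^ m :: real) (at 0) sequentially"
    by (auto simp: filterlim_at intro!: LIMSEQ_divide_realpow_zero)
  ultimately have lim: "(\<lambda>m. D (1 / 2 ^ m)) \<longlonglongrightarrow> L x"
    by (rule filterlim_compose)
  have "D (1 / 2 ^ m) = (e \<bullet> D (1 / 2 ^ m)) *\<^sub>R x" for m
  proof -
    obtain c where c: "\<Phi> (1 / 2 ^ m) x = c *\<^sub>R x" using dyadic[of m] unfolding eig_def by blast
    have "\<Phi> (1 / 2 ^ m) x - x = (c - 1) *\<^sub>R x" by (simp add: c scaleR_diff_left)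
    then show ?thesis using e[OF x(1)] by (simp add: D_def)
  qed
  moreover have "(\<lambda>m. (e \<bullet> D (1 / 2 ^ m)) *\<^sub>R x) \<longlonglongrightarrow> (e \<bullet> L x) *\<^sub>R x"
    by (intro tendsto_intros lim)
  ultimately have "L x = (e \<bullet> L x) *\<^sub>R x"
    using lim LIMSEQ_unique by auto
  with x(1) that show thesis by blast
qed

section \<open>The dual cone of the attainable displacements\<close>

text \<open>
  The pairing of the costate \<open>\<eta>\<close> with the displacement caused by a unit impulse of input \<open>s\<close>
  at time \<open>t\<close>.
\<close>

definition response ::
  "real^'n^'n \<Rightarrow> ('q \<Rightarrow> 'p::finite \<Rightarrow> real^'n) \<Rightarrow> real^'n^'q \<Rightarrow> 'p \<Rightarrow> real \<Rightarrow> real" where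
  "response A B \<eta> s t = (\<Sum>i\<in>UNIV. \<eta> $ i \<bullet> (matrix_exp A (- t) *v B i s))"

lemma continuous_on_response: "continuous_on S (response A B \<eta> s)"
  unfolding response_def by (intro continuous_intros)

lemma inner_displacement_has_integral:
  fixes B :: "'q::finite \<Rightarrow> 'p::finite \<Rightarrow> real^'n"
  assumes u: "\<And>s. u s absolutely_integrable_on {0..T}"
  shows "((\<lambda>r. \<Sum>s\<in>UNIV. u s r * response A B \<eta> s r) has_integral \<eta> \<bullet> displacement A B T u) {0..T}"
proof -
  have "((\<lambda>r. \<eta> $ i \<bullet> (matrix_exp A (- r) *v (\<Sum>s\<in>UNIV. u s r *\<^sub>R B i s)))
      has_integral \<eta> $ i \<bullet> displacement A B T u $ i) {0..T}" for i
    using has_integral_linear[OF displacement_has_integral[where u = u, OF u] bounded_linear_inner_right]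
    by (simp add: o_def)
  then have "((\<lambda>r. \<Sum>i\<in>UNIV. \<eta> $ i \<bullet> (matrix_exp A (- r) *v (\<Sum>s\<in>UNIV. u s r *\<^sub>R B i s)))
      has_integral (\<Sum>i\<in>UNIV. \<eta> $ i \<bullet> displacement A B T u $ i)) {0..T}"
    by (intro has_integral_sum) auto
  moreover have "(\<Sum>i\<in>UNIV. \<eta> $ i \<bullet> (matrix_exp A (- r) *v (\<Sum>s\<in>UNIV. u s r *\<^sub>R B i s)))
      = (\<Sum>s\<in>UNIV. u s r * response A B \<eta> s r)" for r
    unfolding response_def
    by (simp add: linear_sum[OF matrix_vector_mul_linear] matrix_vector_mult_scaleR inner_sum_right
        sum_distrib_left, rule sum.swap)
  ultimately show ?thesis by (simp add: inner_vec_def)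
qed

text \<open>
  These are the costates in the deviation space that are nonnegative on all displacements of
  nonnegative inputs. In this pointwise form it is evident that a shift of \<open>t\<close>, which is the effect of
  the adjoint flow, preserves the condition.
\<close>

definition dual_cone :: "real^'n^'n \<Rightarrow> ('q::finite \<Rightarrow> 'p::finite \<Rightarrow> real^'n) \<Rightarrow> (real^'n^'q) set" where
  "dual_cone A B = {\<eta> \<in> relative_space. \<forall>s. \<forall>t\<ge>0. 0 \<le> response A B \<eta> s t}"

lemma dual_cone_inner_nonneg:
  assumes "\<eta> \<in> dual_cone A B" "y \<in> displacements A B {0..}"
  shows "0 \<le> \<eta> \<bullet> y"
proof -
  from assms(2) obtain T u where u: "\<And>s. u s absolutely_integrable_on {0..T}" 
    "\<And>s t. t \<in> {0..T} \<Longrightarrow> 0 \<le> u s t" and y: "y = displacement A B T u"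
    unfolding displacements_def by fastforce
  show ?thesis unfolding y
    by (rule has_integral_nonneg[OF inner_displacement_has_integral[where u = u, OF u(1)]])
      (use assms(1) u(2) in \<open>auto simp: dual_cone_def intro!: sum_nonneg\<close>)
qed

text \<open>
  Testing with the input \<open>max 0 (- response)\<close> in a single channel gives a displacement whose product
  with \<open>\<eta>\<close> is minus the integral of the square of that input. It is nonnegative by assumption, so the
  continuous input vanishes.
\<close>

lemma dual_coneI:
  fixes B :: "'q::finite \<Rightarrow> 'p::finite \<Rightarrow> real^'n"
  assumes \<eta>: "\<eta> \<in> relative_space"
    and pos: "\<And>y. y \<in> displacements A B {0..} \<Longrightarrow> 0 \<le> \<eta> \<bullet> y"
  shows "\<eta> \<in> dual_cone A B"
proof -
  have "0 \<le> response A B \<eta> s t" if t: "0 \<le> t" for s t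
  proof -
    define v where "v = (\<lambda>r. max 0 (- response A B \<eta> s r))"
    \<comment> \<open>The horizon \<open>t + 1\<close> below keeps the interval nondegenerate when \<open>t = 0\<close>.\<close>
    define u where "u = (\<lambda>s' r. if s' = s then v r else 0)"
    have contv: "continuous_on S v" for S
      unfolding v_def by (intro continuous_intros continuous_on_response)
    have u: "u s' absolutely_integrable_on {0..t + 1}" for s'
      unfolding u_def by (cases "s' = s") (auto intro!: absolutely_integrable_continuous_real contv)
    have "displacement A B (t + 1) u \<in> displacements A B {0..}"
      by (rule displacementsI) (use t u in \<open>auto simp: u_def v_def\<close>)
    then have ge: "0 \<le> \<eta> \<bullet> displacement A B (t + 1) u" by (rule pos)
    have "((\<lambda>r. - (v r)\<^sup>2) has_integral \<eta> \<bullet> displacement A B (t + 1) u) {0..t + 1}"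
    proof (rule has_integral_eq[OF _ inner_displacement_has_integral[where u = u, OF u]])
      fix r
      have "(\<Sum>s'\<in>UNIV. u s' r * response A B \<eta> s' r) = (\<Sum>s'\<in>UNIV. if s' = s then v r * response A B \<eta> s r else 0)"
        by (rule sum.cong) (auto simp: u_def)
      also have "\<dots> = - (v r)\<^sup>2"
        by (simp add: v_def max_def power2_eq_square)
      finally show "(\<Sum>s'\<in>UNIV. u s' r * response A B \<eta> s' r) = - (v r)\<^sup>2" .
    qed
    from has_integral_neg[OF this]
    have sq: "((\<lambda>r. (v r)\<^sup>2) has_integral - (\<eta> \<bullet> displacement A B (t + 1) u)) {0..t + 1}"
      by simp
    moreover from sq have "0 \<le> - (\<eta> \<bullet> displacement A B (t + 1) u)"
      by (rule has_integral_nonneg) auto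
    ultimately have "integral {0..t + 1} (\<lambda>r. (v r)\<^sup>2) = 0" using ge
      by (simp add: integral_unique)
    moreover have "continuous_on {0..t + 1} (\<lambda>r. (v r)\<^sup>2)"
      by (intro continuous_intros contv)
    ultimately have "v t = 0"
      using integral_eq_0_iff[of 0 "t + 1" "\<lambda>r. (v r)\<^sup>2"] t by auto
    then show ?thesis by (simp add: v_def max_def split: if_splits)
  qed
  with \<eta> show ?thesis by (simp add: dual_cone_def)
qed

lemma subspace_relative_space: "subspace relative_space"
  by (auto simp: subspace_def relative_space_def sum.distrib scaleR_sum_right[symmetric])

text \<open>
  The separating hyperplane must have its normal in the space spanned by the deviations, because a
  normal with equal blocks separates nothing there; hence the separation
  relative to the affine hull. The sign follows by scaling, since the attainable displacements form a cone.
\<close>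

lemma dual_cone_nontrivial:
  fixes B :: "'q::finite \<Rightarrow> 'p::finite \<Rightarrow> real^'n"
  assumes rel: "relative_actuation B" and w: "w \<in> relative_space" "w \<notin> displacements A B {0..}"
  obtains \<eta> where "\<eta> \<in> dual_cone A B" "\<eta> \<noteq> 0"
proof -
  let ?C = "displacements A B {0..}"
  have "convex ?C"
    unfolding convex_def using displacements_nonneg_cone by blast
  moreover have "?C \<noteq> {}" using zero_in_displacements by blast
  ultimately obtain \<eta> b where \<eta>: "w + \<eta> \<in> affine hull (insert w ?C)" "\<eta> \<noteq> 0"
    and sep: "\<And>y. y \<in> ?C \<Longrightarrow> b \<le> \<eta> \<bullet> y"
    using separating_hyperplane_set_point_inaff[OF _ _ w(2)] by metis
  have "affine hull (insert w ?C) \<subseteq> relative_space"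
    using w(1) displacements_subset[OF rel, of A "{0..}"]
    by (intro hull_minimal) (auto intro: subspace_imp_affine subspace_relative_space)
  then have "\<eta> \<in> relative_space"
    using \<eta>(1) w(1) subspace_diff[OF subspace_relative_space, of "w + \<eta>" w] by auto
  moreover have "0 \<le> \<eta> \<bullet> y" if y: "y \<in> ?C" for y
  proof (rule ccontr)
    assume neg: "\<not> 0 \<le> \<eta> \<bullet> y"
    \<comment> \<open>The multiple of \<open>y\<close> on which \<open>\<eta>\<close> takes the value \<open>- (\<bar>b\<bar> + 1) < b\<close>.\<close>
    define k where "k = (\<bar>b\<bar> + 1) / - (\<eta> \<bullet> y)"
    have "0 \<le> k" unfolding k_def by (rule divide_nonneg_pos) (use neg in auto)
    then have "k *\<^sub>R y \<in> ?C"
      using displacements_nonneg_cone[OF y zero_in_displacements, of k 0] by simp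
    then have "b \<le> k * (\<eta> \<bullet> y)" using sep by fastforce
    also have "\<dots> = - (\<bar>b\<bar> + 1)" using neg by (simp add: k_def)
    finally show False by linarith
  qed
  ultimately show thesis using dual_coneI \<eta>(2) that by blast
qed

text \<open>
  Each basis vector has, up to a vector with equal blocks, the form \<open>y - z\<close> with \<open>y\<close> and \<open>z\<close> attainable by
  nonnegative inputs. Costates in the dual cone are nonnegative on \<open>y\<close> and \<open>z\<close>, so the
  sum of all these vectors bounds every coordinate of such a costate. The bound makes that
  sum a functional that is positive on the nonzero costates of the dual cone and
  has bounded level sets there.
\<close>

lemma controllable_dominating_vector:
  fixes B :: "'q::finite \<Rightarrow> 'p::finite \<Rightarrow> real^'n"
  assumes rel: "relative_actuation B" and ctrl: "controllable A B"
  obtains e where "\<And>\<eta> b. \<eta> \<in> dual_cone A B \<Longrightarrow> b \<in> Basis \<Longrightarrow> \<bar>\<eta> \<bullet> b\<bar> \<le> \<eta> \<bullet> e"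
proof -
  let ?C = "displacements A B {0..}"
  have "\<exists>y z. y \<in> ?C \<and> z \<in> ?C \<and> (\<forall>\<eta>\<in>relative_space. \<eta> \<bullet> b = \<eta> \<bullet> (y - z))" for b :: "real^'n^'q"
  proof -
    define a where "a = (\<Sum>i\<in>UNIV. b $ i) /\<^sub>R CARD('q)"
    have "(\<Sum>i::'q\<in>UNIV. a) = (\<Sum>i\<in>UNIV. b $ i)"
      by (simp add: a_def sum_constant_scaleR del: sum_constant)
    then have "b - (\<chi> i. a) \<in> relative_space"
      by (simp add: relative_space_def sum_subtractf del: sum_constant)
    then have "b - (\<chi> i. a) \<in> displacements A B UNIV"
      using ctrl unfolding controllable_iff_displacements[OF rel] by blast
    then obtain y z where "y \<in> ?C" "z \<in> ?C" and yz: "b - (\<chi> i. a) = y - z"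
      by (rule displacements_eq_difference)
    moreover have "\<eta> \<bullet> b = \<eta> \<bullet> (b - (\<chi> i. a))" if "\<eta> \<in> relative_space" for \<eta>
    proof -
      have "\<eta> \<bullet> (\<chi> i. a) = (\<Sum>i\<in>UNIV. \<eta> $ i) \<bullet> a"
        unfolding inner_sum_left by (simp add: inner_vec_def[of \<eta>])
      then show ?thesis using that by (simp add: relative_space_def inner_diff_right)
    qed
    ultimately show ?thesis unfolding yz by blast
  qed
  then obtain Y Z where YZ: "\<And>b. Y b \<in> ?C" "\<And>b. Z b \<in> ?C"
    "\<And>b \<eta>. \<eta> \<in> relative_space \<Longrightarrow> \<eta> \<bullet> b = \<eta> \<bullet> (Y b - Z b)" by metis
  show thesis
  proof (rule that[of "\<Sum>b\<in>Basis. Y b + Z b"])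
    fix \<eta> b assume \<eta>: "\<eta> \<in> dual_cone A B" and b: "b \<in> (Basis :: (real^'n^'q) set)"
    have nn: "0 \<le> \<eta> \<bullet> Y c" "0 \<le> \<eta> \<bullet> Z c" for c
      using dual_cone_inner_nonneg[OF \<eta>] YZ by auto
    have "\<eta> \<bullet> b = \<eta> \<bullet> Y b - \<eta> \<bullet> Z b"
      using YZ(3)[of \<eta> b] \<eta> by (simp add: dual_cone_def inner_diff_right)
    then have "\<bar>\<eta> \<bullet> b\<bar> \<le> \<eta> \<bullet> (Y b + Z b)"
      using nn[of b] by (simp add: inner_add_right)
    also have "\<dots> \<le> (\<Sum>b\<in>Basis. \<eta> \<bullet> (Y b + Z b))"
      using b nn by (intro member_le_sum) (auto simp: inner_add_right)
    finally show "\<bar>\<eta> \<bullet> b\<bar> \<le> \<eta> \<bullet> (\<Sum>b\<in>Basis. Y b + Z b)"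
      by (simp add: inner_sum_right)
  qed
qed

text \<open>
  The adjoint flow: the pairing of \<open>costate_flow A h \<eta>\<close> with \<open>y\<close> is that of \<open>\<eta>\<close> with the blocks
  \<open>e\<^bsup>-hA\<^esup> y\<^sub>i\<close>.
\<close>

definition costate_flow :: "real^'n^'n \<Rightarrow> real \<Rightarrow> real^'n^'q \<Rightarrow> real^'n^'q" where
  "costate_flow A h \<eta> = (\<chi> i. transpose (matrix_exp A (- h)) *v (\<eta> $ i))"

lemma inner_transpose: "(transpose M *v x) \<bullet> y = x \<bullet> (M *v y)" for M :: "real^'n^'m"
  by (simp add: dot_lmul_matrix)

lemma response_costate_flow: "response A B (costate_flow A h \<eta>) s t = response A B \<eta> s (h + t)"
proof -
  have "matrix_exp A (- h) *v (matrix_exp A (- t) *v B i s) = matrix_exp A (- (h + t)) *v B i s" for i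
    by (simp add: matrix_exp_add_vec)
  then show ?thesis
    by (simp add: response_def costate_flow_def inner_transpose del: transpose_matrix_vector)
qed

lemma linear_costate_flow: "linear (costate_flow A h)"
  unfolding costate_flow_def
  by (rule linearI) (simp_all add: vec_eq_iff matrix_vector_right_distrib matrix_vector_mult_scaleR
      del: transpose_matrix_vector)

lemma costate_flow_dual_cone:
  assumes "\<eta> \<in> dual_cone A B" "0 \<le> h"
  shows "costate_flow A h \<eta> \<in> dual_cone A B"
proof -
  have "(\<Sum>i\<in>UNIV. costate_flow A h \<eta> $ i) = transpose (matrix_exp A (- h)) *v (\<Sum>i\<in>UNIV. \<eta> $ i)"
    by (simp add: costate_flow_def linear_sum[OF matrix_vector_mul_linear] del: transpose_matrix_vector)
  with assms show ?thesis
    by (auto simp: dual_cone_def relative_space_def response_costate_flow)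
qed

lemma costate_flow_semigroup: "costate_flow A s (costate_flow A t \<eta>) = costate_flow A (s + t) \<eta>"
proof -
  have "transpose (matrix_exp A (- s)) *v (transpose (matrix_exp A (- t)) *v x)
      = transpose (matrix_exp A (- (s + t))) *v x" for x
    unfolding matrix_vector_mul_assoc matrix_transpose_mul[symmetric] matrix_exp_add
    by (simp add: add.commute del: transpose_matrix_vector)
  then show ?thesis
    by (simp add: costate_flow_def vec_eq_iff del: transpose_matrix_vector)
qed

lemma costate_flow_0: "costate_flow A 0 \<eta> = \<eta>"
  by (simp add: costate_flow_def vec_eq_iff del: transpose_matrix_vector)

lemma costate_flow_deriv:
  fixes \<eta> :: "real^'n^'q"
  shows "((\<lambda>h. costate_flow A h \<eta>) has_vector_derivative (\<chi> i. transpose (- A) *v (\<eta> $ i))) (at 0)"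
proof -
  have "linear (\<lambda>M::real^'n^'n. \<chi> i::'q. transpose M *v (\<eta> $ i))"
    by (rule linearI) (simp_all add: vec_eq_iff transpose_def matrix_vector_mult_def
        sum.distrib algebra_simps sum_distrib_left)
  then have "bounded_linear (\<lambda>M::real^'n^'n. \<chi> i::'q. transpose M *v (\<eta> $ i))"
    by (simp add: linear_conv_bounded_linear)
  from bounded_linear.has_vector_derivative[OF this matrix_exp_minus_deriv[where c = 0 and t = 0 and A = A]]
  show ?thesis
    by (simp add: costate_flow_def del: transpose_matrix_vector)
qed

text \<open>
  The dual cone is nonzero and invariant under the adjoint flow, and controllability gives it the
  compact convex base \<open>\<Delta>\<close>; so the flow has an eigenvector there. Its generator acts as \<open>-A\<^sup>T\<close> on each
  block, which turns an eigenvalue \<open>c\<close> of the generator into the eigenvalue \<open>-c\<close> of \<open>A\<^sup>T\<close>, common to all blocks.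
\<close>

lemma eigenvector_in_dual_cone:
  fixes A :: "real^'n^'n" and B :: "'q::finite \<Rightarrow> 'p::finite \<Rightarrow> real^'n"
  assumes rel: "relative_actuation B" and ctrl: "controllable A B"
    and npos: "\<not> positively_controllable A B"
  obtains \<eta> c where "\<eta> \<in> dual_cone A B" "\<eta> \<noteq> 0" "\<And>i. transpose A *v (\<eta> $ i) = c *\<^sub>R (\<eta> $ i)"
proof -
  obtain \<eta>0 where \<eta>0: "\<eta>0 \<in> dual_cone A B" "\<eta>0 \<noteq> 0"
    using npos dual_cone_nontrivial[OF rel] positively_controllable_iff_displacements[OF rel]
    by (metis subsetI)
  obtain e where e: "\<And>\<eta> b. \<eta> \<in> dual_cone A B \<Longrightarrow> b \<in> Basis \<Longrightarrow> \<bar>\<eta> \<bullet> b\<bar> \<le> \<eta> \<bullet> e"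
    using controllable_dominating_vector[OF rel ctrl] by metis
  have e_pos: "0 < e \<bullet> \<eta>" if \<eta>: "\<eta> \<in> dual_cone A B" "\<eta> \<noteq> 0" for \<eta>
  proof -
    obtain b where "b \<in> Basis" "\<eta> \<bullet> b \<noteq> 0"
      using \<eta>(2) euclidean_all_zero_iff by blast
    with e[OF \<eta>(1)] show ?thesis by (force simp: inner_commute)
  qed
  have scale: "c *\<^sub>R \<eta> \<in> dual_cone A B" if "\<eta> \<in> dual_cone A B" "0 \<le> c" for c \<eta>
    using that by (auto simp: dual_cone_def relative_space_def response_def
        scaleR_sum_right[symmetric] sum_distrib_left[symmetric])
  have flow_nz: "costate_flow A h \<eta> \<noteq> 0" if "\<eta> \<noteq> 0" for h \<eta>
  proof
    assume "costate_flow A h \<eta> = 0"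
    then have "costate_flow A (- h + h) \<eta> = 0"
      by (simp only: costate_flow_semigroup[symmetric] linear_0[OF linear_costate_flow])
    with that show False by (simp add: costate_flow_0)
  qed
  define \<Delta> where "\<Delta> = dual_cone A B \<inter> {\<eta>. e \<bullet> \<eta> = 1}"
  have \<Delta>_nz: "\<eta> \<noteq> 0" if "\<eta> \<in> \<Delta>" for \<eta> using that by (auto simp: \<Delta>_def)
  have normalize: "\<eta> /\<^sub>R (e \<bullet> \<eta>) \<in> \<Delta>" if "\<eta> \<in> dual_cone A B" "\<eta> \<noteq> 0" for \<eta>
    using scale[OF that(1), of "inverse (e \<bullet> \<eta>)"] e_pos[OF that] by (simp add: \<Delta>_def)
  have "closed (dual_cone A B)"
  proof -
    have "dual_cone A B = {\<eta>. (\<Sum>i\<in>UNIV. \<eta> $ i) = 0} \<inter> (\<Inter>s. \<Inter>t\<in>{0..}. {\<eta>. 0 \<le> response A B \<eta> s t})"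
      by (auto simp: dual_cone_def relative_space_def)
    also have "closed \<dots>"
      unfolding response_def
      by (intro closed_Int closed_INT ballI closed_Collect_eq closed_Collect_le continuous_intros)
    finally show ?thesis .
  qed
  then have "closed \<Delta>"
    unfolding \<Delta>_def by (intro closed_Int closed_Collect_eq continuous_intros)
  moreover have "bounded \<Delta>"
  proof -
    have "norm \<eta> \<le> (\<Sum>b\<in>(Basis :: (real^'n^'q) set). 1)" if "\<eta> \<in> \<Delta>" for \<eta>
    proof -
      have "norm \<eta> \<le> (\<Sum>b\<in>Basis. \<bar>\<eta> \<bullet> b\<bar>)" by (rule norm_le_l1)
      also have "\<dots> \<le> (\<Sum>b\<in>(Basis :: (real^'n^'q) set). 1)"
        using e[of \<eta>] that by (intro sum_mono) (auto simp: \<Delta>_def inner_commute)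
      finally show ?thesis .
    qed
    then show ?thesis unfolding bounded_iff by blast
  qed
  ultimately have "compact \<Delta>" by (simp add: compact_eq_bounded_closed)
  have "convex \<Delta>"
  proof -
    have "convex (dual_cone A B)"
      unfolding convex_def dual_cone_def relative_space_def response_def
      by (auto simp: inner_add_left sum.distrib scaleR_sum_right[symmetric] sum_distrib_left[symmetric]
          intro!: add_nonneg_nonneg mult_nonneg_nonneg)
    then show ?thesis
      unfolding \<Delta>_def by (intro convex_Int) (auto simp: convex_hyperplane)
  qed
  have "\<Delta> \<noteq> {}" using normalize[OF \<eta>0] by blast
  obtain \<eta> c where \<eta>: "\<eta> \<in> \<Delta>" "(\<chi> i. transpose (- A) *v (\<eta> $ i)) = c *\<^sub>R \<eta>"
  proof (rule eigenvector_of_generator[where \<Phi> = "costate_flow A" and e = e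
        and L = "\<lambda>\<eta>. \<chi> i. transpose (- A) *v (\<eta> $ i)", OF \<open>compact \<Delta>\<close> \<open>convex \<Delta>\<close> \<open>\<Delta> \<noteq> {}\<close>])
    show "linear (costate_flow A h)" for h by (rule linear_costate_flow)
    show "costate_flow A s (costate_flow A t x) = costate_flow A (s + t) x" for s t x
      by (rule costate_flow_semigroup)
    show "costate_flow A 0 x = x" for x by (rule costate_flow_0)
    show "((\<lambda>h. costate_flow A h x) has_vector_derivative (\<chi> i. transpose (- A) *v x $ i)) (at 0)" for x
      by (rule costate_flow_deriv)
    show "e \<bullet> x = 1" if "x \<in> \<Delta>" for x using that by (simp add: \<Delta>_def)
    show "0 < e \<bullet> costate_flow A h x" "costate_flow A h x /\<^sub>R (e \<bullet> costate_flow A h x) \<in> \<Delta>"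
      if "0 \<le> h" "x \<in> \<Delta>" for h x
    proof -
      have "costate_flow A h x \<in> dual_cone A B" "costate_flow A h x \<noteq> 0"
        using that \<Delta>_nz by (auto simp: \<Delta>_def intro!: costate_flow_dual_cone flow_nz)
      then show "0 < e \<bullet> costate_flow A h x" "costate_flow A h x /\<^sub>R (e \<bullet> costate_flow A h x) \<in> \<Delta>"
        by (rule e_pos, rule normalize)
    qed
  qed (rule that)
  show thesis
  proof (rule that)
    show "\<eta> \<in> dual_cone A B" "\<eta> \<noteq> 0" using \<eta>(1) \<Delta>_nz by (auto simp: \<Delta>_def)
    fix i
    have "transpose (- A) *v (\<eta> $ i) = c *\<^sub>R (\<eta> $ i)"
      using \<eta>(2) by (metis vec_lambda_beta vector_scaleR_component)
    moreover have "transpose (- A) = - transpose A"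
      by (simp add: transpose_def vec_eq_iff)
    ultimately show "transpose A *v (\<eta> $ i) = (- c) *\<^sub>R (\<eta> $ i)"
      by (metis minus_matrix_vector_mult minus_minus scaleR_minus_left)
  qed
qed

section \<open>Real eigenvector matrices and the incidence matrix\<close>

lemma ones_kron_id_apply:
  "mat_apply (block_rows d) {..<d} ones_kron_id z = (\<lambda>(i, j). if j < d then z j else 0)"
  by (auto simp: mat_apply_def block_rows_def ones_kron_id_def fun_eq_iff if_distrib[of "\<lambda>x. x * _"]
      cong: if_cong)

text \<open>
  The synchronization subspace consists of the vectors with equal blocks, so orthogonality to it
  says that the blocks sum to zero.
\<close>

lemma S_perp_iff:
  fixes w :: "'q::finite \<times> nat \<Rightarrow> real"
  shows "w \<in> S_perp d \<longleftrightarrow> w \<in> block_space d \<and> (\<forall>j<d. (\<Sum>i\<in>UNIV. w (i, j)) = 0)"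
proof -
  have eq: "(\<Sum>r\<in>block_rows d. w r * mat_apply (block_rows d) {..<d} ones_kron_id z r)
      = (\<Sum>j<d. (\<Sum>i\<in>UNIV. w (i, j)) * z j)" for z
  proof -
    have "(\<Sum>r\<in>block_rows d. w r * mat_apply (block_rows d) {..<d} ones_kron_id z r)
        = (\<Sum>i\<in>UNIV. \<Sum>j<d. w (i, j) * z j)"
      unfolding ones_kron_id_apply unfolding block_rows_def sum.cartesian_product
      by (intro sum.cong) auto
    then show ?thesis
      by (subst (asm) sum.swap) (simp add: sum_distrib_right)
  qed
  have "(\<forall>z. (\<Sum>j<d. (\<Sum>i\<in>UNIV. w (i, j)) * z j) = 0) \<longleftrightarrow> (\<forall>j<d. (\<Sum>i\<in>UNIV. w (i, j)) = 0)"
  proof (intro iffI allI impI)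
    fix j assume "\<forall>z. (\<Sum>j<d. (\<Sum>i\<in>UNIV. w (i, j)) * z j) = 0" "j < d"
    from spec[OF this(1), of "\<lambda>k. if k = j then 1 else 0"] this(2)
    show "(\<Sum>i\<in>UNIV. w (i, j)) = 0"
      by (simp add: if_distrib[of "\<lambda>x. _ * x"] cong: if_cong)
  qed simp
  then show ?thesis
    by (simp add: S_perp_def S_space_def eq)
qed

definition Re_vec :: "complex^'n \<Rightarrow> real^'n" where
  "Re_vec v = (\<chi> k. Re (v $ k))"

definition of_real_vec :: "real^'n \<Rightarrow> complex^'n" where
  "of_real_vec x = (\<chi> k. complex_of_real (x $ k))"

lemma Re_vec_of_real_vec [simp]: "Re_vec (of_real_vec x) = x"
  by (simp add: Re_vec_def of_real_vec_def)

lemma of_real_vec_Re_vec: "\<forall>k. v $ k \<in> \<real> \<Longrightarrow> of_real_vec (Re_vec v) = v"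
  by (simp add: Re_vec_def of_real_vec_def vec_eq_iff)

lemma mult_of_real_vec:
  "conj_transpose (map_matrix complex_of_real A) *v of_real_vec x = of_real_vec (transpose A *v x)"
  by (simp add: conj_transpose_def map_matrix_def of_real_vec_def matrix_vector_mult_def transpose_def
      del: transpose_matrix_vector)

lemma of_real_vec_in_null_space_iff:
  "of_real_vec x \<in> null_space (conj_transpose (map_matrix complex_of_real A) - mat (complex_of_real c))
    \<longleftrightarrow> transpose A *v x = c *\<^sub>R x"
proof -
  have "mat (complex_of_real c) *v of_real_vec x = of_real_vec (c *\<^sub>R x)"
    by (simp add: mat_def of_real_vec_def matrix_vector_mult_def vec_eq_iff if_distrib[of "\<lambda>y. y * _"]
        cong: if_cong)
  moreover have "of_real_vec y = of_real_vec z \<longleftrightarrow> y = z" for y z :: "real^'n"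
    by (metis Re_vec_of_real_vec)
  ultimately show ?thesis
    by (simp add: null_space_def matrix_vector_mult_diff_rdistrib mult_of_real_vec del: transpose_matrix_vector)
qed

lemma real_conj_transpose_mult:
  "Re (conj_transpose_mult V b j) = Re_vec (V j) \<bullet> b"
  by (simp add: conj_transpose_mult_def Re_vec_def inner_vec_def)

lemma real_inc_apply:
  fixes B :: "'q::finite \<Rightarrow> 'p::finite \<Rightarrow> real^'n"
  shows "mat_apply (block_rows d) UNIV (real_matrix (inc (\<lambda>i s. conj_transpose_mult V (B i s)))) a
    = (\<lambda>(i, j). if j < d then \<Sum>s\<in>UNIV. (Re_vec (V j) \<bullet> B i s) * a s else 0)"
  by (auto simp: mat_apply_def block_rows_def real_matrix_def inc_def real_conj_transpose_mult fun_eq_iff)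

lemma class_G_inc:
  fixes B :: "'q::finite \<Rightarrow> 'p::finite \<Rightarrow> real^'n"
  assumes rel: "relative_actuation B"
  shows "class_G d (real_matrix (inc (\<lambda>i s. conj_transpose_mult V (B i s))))"
proof -
  have "(\<Sum>i\<in>UNIV. \<Sum>s\<in>UNIV. (v \<bullet> B i s) * a s) = 0" for v a
  proof -
    have "(\<Sum>i\<in>UNIV. \<Sum>s\<in>UNIV. (v \<bullet> B i s) * a s) = (\<Sum>s\<in>UNIV. (v \<bullet> (\<Sum>i\<in>UNIV. B i s)) * a s)"
      by (subst sum.swap) (simp add: inner_sum_right sum_distrib_right)
    with rel show ?thesis by (simp add: relative_actuation_def)
  qed
  then show ?thesis
    unfolding class_G_def real_inc_apply by (auto simp: S_perp_iff block_space_def block_rows_def)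
qed

text \<open>
  For a real eigenvalue the complex eigenvector matrix is the embedding of a real one, whose columns
  form a basis of the corresponding eigenspace of \<open>A\<^sup>T\<close>.
\<close>

context
  fixes A :: "real^'n^'n" and c :: real and d :: nat and V :: "nat \<Rightarrow> complex^'n"
  assumes V: "eigenvector_matrix (conj_transpose (map_matrix complex_of_real A)) (complex_of_real c) d V"
begin

lemma real_columns: "j < d \<Longrightarrow> of_real_vec (Re_vec (V j)) = V j"
  using V by (intro of_real_vec_Re_vec) (simp add: eigenvector_matrix_def)

lemma real_columns_eigenvectors:
  assumes "j < d"
  shows "transpose A *v Re_vec (V j) = c *\<^sub>R Re_vec (V j)"
proof -
  have "V j = (\<Sum>k<d. (if k = j then 1 else 0) *s V k)"
    using assms by (simp add: if_distrib[of "\<lambda>x. x *s _"] cong: if_cong)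
  then have "V j \<in> column_range d V"
    unfolding column_range_def by (intro CollectI exI[of _ "\<lambda>k. if k = j then 1 else 0"]) simp
  then have "of_real_vec (Re_vec (V j)) \<in> null_space (conj_transpose (map_matrix complex_of_real A) - mat (complex_of_real c))"
    using V assms by (simp add: eigenvector_matrix_def real_columns)
  then show ?thesis by (simp only: of_real_vec_in_null_space_iff)
qed

lemma real_columns_span:
  assumes "transpose A *v x = c *\<^sub>R x"
  obtains z where "x = (\<Sum>j<d. z j *\<^sub>R Re_vec (V j))"
proof -
  have "of_real_vec x \<in> column_range d V"
    using assms V unfolding eigenvector_matrix_def by (simp only: of_real_vec_in_null_space_iff)
  then obtain z where z: "of_real_vec x = (\<Sum>j<d. z j *s V j)"
    by (auto simp: column_range_def)
  have "x $ k = (\<Sum>j<d. Re (z j) *\<^sub>R Re_vec (V j)) $ k" for k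
  proof -
    have "x $ k = Re (\<Sum>j<d. z j * V j $ k)"
      using arg_cong[OF z, of "\<lambda>v. Re (v $ k)"] by (simp add: of_real_vec_def)
    also have "\<dots> = (\<Sum>j<d. Re (z j) * Re (V j $ k))"
      unfolding Re_sum
    proof (rule sum.cong)
      fix j assume "j \<in> {..<d}"
      then have "Im (V j $ k) = 0"
        using V by (simp add: eigenvector_matrix_def complex_is_Real_iff)
      then show "Re (z j * V j $ k) = Re (z j) * Re (V j $ k)" by simp
    qed simp
    finally show ?thesis by (simp add: Re_vec_def)
  qed
  then have "x = (\<Sum>j<d. Re (z j) *\<^sub>R Re_vec (V j))"
    by (simp add: vec_eq_iff)
  then show thesis by (rule that)
qed

text \<open>
  The columns are real, so a real linear relation between their real parts is a complex linear relation
  between the columns themselves.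
\<close>

lemma real_columns_independent:
  "inj_on (\<lambda>j. Re_vec (V j)) {..<d}" "independent ((\<lambda>j. Re_vec (V j)) ` {..<d})"
proof -
  have dim: "vec.dim (V ` {..<d}) = d"
    using V by (simp add: eigenvector_matrix_def full_column_rank_def)
  have "card (V ` {..<d}) \<le> d"
    using card_image_le[of "{..<d}" V] by simp
  moreover have "d \<le> card (V ` {..<d})"
    using vec.dim_le_card'[of "V ` {..<d}"] dim by simp
  ultimately have card: "card (V ` {..<d}) = d" by simp
  then have inj: "inj_on V {..<d}"
    by (intro eq_card_imp_inj_on) auto
  have ind: "vec.independent (V ` {..<d})"
    by (rule vec.card_le_dim_spanning[of _ "V ` {..<d}"]) (auto simp: card dim vec.span_base)
  show inj': "inj_on (\<lambda>j. Re_vec (V j)) {..<d}"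
  proof (rule inj_onI)
    fix j k assume jk: "j \<in> {..<d}" "k \<in> {..<d}" "Re_vec (V j) = Re_vec (V k)"
    then have "V j = V k" using real_columns by (metis lessThan_iff)
    with inj jk show "j = k" by (auto dest: inj_onD)
  qed
  show "independent ((\<lambda>j. Re_vec (V j)) ` {..<d})"
  proof
    assume "dependent ((\<lambda>j. Re_vec (V j)) ` {..<d})"
    then obtain u j where u: "(\<Sum>x\<in>(\<lambda>j. Re_vec (V j)) ` {..<d}. u x *\<^sub>R x) = 0"
      and j: "j < d" "u (Re_vec (V j)) \<noteq> 0"
      by (auto simp: dependent_finite)
    have sum0: "(\<Sum>j<d. u (Re_vec (V j)) *\<^sub>R Re_vec (V j)) = 0"
      using u by (simp add: sum.reindex[OF inj'])
    have "(\<Sum>X\<in>V ` {..<d}. complex_of_real (u (Re_vec X)) *s X) = (\<Sum>j<d. complex_of_real (u (Re_vec (V j))) *s V j)"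
      by (simp add: sum.reindex[OF inj])
    also have "\<dots> = (\<Sum>j<d. of_real_vec (u (Re_vec (V j)) *\<^sub>R Re_vec (V j)))"
      by (rule sum.cong) (auto simp: of_real_vec_def vec_eq_iff Re_vec_def
          intro: complex_eqI dest!: real_columns)
    also have "\<dots> = of_real_vec (\<Sum>j<d. u (Re_vec (V j)) *\<^sub>R Re_vec (V j))"
      by (simp add: of_real_vec_def vec_eq_iff)
    also have "\<dots> = 0" unfolding sum0 by (simp add: of_real_vec_def vec_eq_iff)
    finally have "vec.dependent (V ` {..<d})"
      unfolding vec.dependent_finite[OF finite_imageI[OF finite_lessThan]]
      using j by (intro exI[of _ "\<lambda>X. complex_of_real (u (Re_vec X))"]) auto
    with ind show False by blast
  qed
qed

text \<open>
  By linear independence some linear functional takes the prescribed values on the columns, and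
  \<open>y\<close> is its representing vector.
\<close>

lemma real_columns_interpolate: "\<exists>y. \<forall>j<d. Re_vec (V j) \<bullet> y = w j"
proof -
  let ?v = "\<lambda>j. Re_vec (V j)"
  obtain g where g: "linear g" "\<And>x. x \<in> ?v ` {..<d} \<Longrightarrow> g x = w (inv_into {..<d} ?v x)"
    using linear_independent_extend[OF real_columns_independent(2), of "\<lambda>x. w (inv_into {..<d} ?v x)"]
    by auto
  have "?v j \<bullet> adjoint g 1 = w j" if "j < d" for j
    using that g(2)[of "?v j"] inv_into_f_f[OF real_columns_independent(1)]
    by (simp add: adjoint_works[OF g(1)])
  then show ?thesis by blast
qed

end

text \<open>
  The product of \<open>e\<^bsup>cr\<^esup>\<close> and \<open>v \<bullet> e\<^bsup>-rA\<^esup> b\<close> has derivative zero, because \<open>v\<close> is a left eigenvector of \<open>A\<close>.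
\<close>

lemma inner_matrix_exp_eigenvector:
  assumes "transpose A *v v = c *\<^sub>R v"
  shows "v \<bullet> (matrix_exp A (- t) *v b) = exp (- c * t) * (v \<bullet> b)"
proof -
  have "((\<lambda>r. exp (c * r) * (v \<bullet> (matrix_exp A (0 - r) *v b))) has_vector_derivative 0) (at r within UNIV)" for r
  proof -
    have "((\<lambda>r. v \<bullet> (matrix_exp A (0 - r) *v b)) has_vector_derivative
        v \<bullet> ((- (A ** matrix_exp A (0 - r))) *v b)) (at r)"
      by (intro bounded_linear.has_vector_derivative[OF bounded_linear_inner_right]
          bounded_linear.has_vector_derivative[OF
            bounded_bilinear.bounded_linear_left[OF bounded_bilinear_matrix_vector_mult]]
          matrix_exp_minus_deriv)
    moreover have "v \<bullet> ((- (A ** matrix_exp A (0 - r))) *v b) = - c * (v \<bullet> (matrix_exp A (0 - r) *v b))"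
      using assms inner_transpose[of A v "matrix_exp A (0 - r) *v b"]
      unfolding minus_matrix_vector_mult matrix_vector_mul_assoc[symmetric] by simp
    ultimately have "((\<lambda>r. v \<bullet> (matrix_exp A (0 - r) *v b)) has_real_derivative
        - c * (v \<bullet> (matrix_exp A (0 - r) *v b))) (at r)"
      by (simp add: has_real_derivative_iff_has_vector_derivative)
    then have "((\<lambda>r. exp (c * r) * (v \<bullet> (matrix_exp A (0 - r) *v b))) has_real_derivative 0) (at r)"
      by (auto intro!: derivative_eq_intros)
    then show ?thesis by (simp add: has_real_derivative_iff_has_vector_derivative)
  qed
  then obtain k where "\<And>r. exp (c * r) * (v \<bullet> (matrix_exp A (0 - r) *v b)) = k"
    using has_vector_derivative_zero_constant[of UNIV "\<lambda>r. exp (c * r) * (v \<bullet> (matrix_exp A (0 - r) *v b))"] by auto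
  from this[of t] this[of 0] show ?thesis
    by (simp add: exp_minus field_simps)
qed

text \<open>
  Given \<open>w\<close> in the complement, choose blocks \<open>y\<^sub>i\<close> with sum zero such that the columns of \<open>V\<close> have
  the products \<open>w\<^sub>i\<close> with \<open>y\<^sub>i\<close>. By positive controllability \<open>y\<close> is the displacement of a nonnegative
  input \<open>u\<close>, and the numbers \<open>\<alpha>\<^sub>s = \<integral> e\<^bsup>-cr\<^esup> u\<^sub>s(r) dr\<close> represent \<open>w\<close> in the cone.
\<close>

lemma strongly_connected_if_positively_controllable:
  fixes A :: "real^'n^'n" and B :: "'q::finite \<Rightarrow> 'p::finite \<Rightarrow> real^'n"
  assumes rel: "relative_actuation B" and pos: "positively_controllable A B"
    and V: "eigenvector_matrix (conj_transpose (map_matrix complex_of_real A)) (complex_of_real c) d V"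
  shows "strongly_connected d (real_matrix (inc (\<lambda>i s. conj_transpose_mult V (B i s))))"
    (is "strongly_connected d ?G")
  unfolding strongly_connected_def
proof (intro conjI subsetI)
  show "class_G d ?G" by (rule class_G_inc[OF rel])
  fix w :: "'q \<times> nat \<Rightarrow> real" assume w: "w \<in> S_perp d"
  define v where "v j = Re_vec (V j)" for j
  have "\<exists>y0. \<forall>i. \<forall>j<d. v j \<bullet> y0 i = w (i, j)"
    unfolding v_def by (intro choice allI real_columns_interpolate[OF V])
  then obtain y0 where y0: "\<And>i j. j < d \<Longrightarrow> v j \<bullet> y0 i = w (i, j)" by blast
  define a where "a = (\<Sum>i\<in>UNIV. y0 i) /\<^sub>R CARD('q)"
  have "(\<Sum>i::'q\<in>UNIV. a) = (\<Sum>i\<in>UNIV. y0 i)"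
    by (simp add: a_def sum_constant_scaleR del: sum_constant)
  then have "(\<chi> i. y0 i - a) \<in> relative_space"
    by (simp add: relative_space_def sum_subtractf del: sum_constant)
  then have "(\<chi> i. y0 i - a) \<in> displacements A B {0..}"
    using pos unfolding positively_controllable_iff_displacements[OF rel] by blast
  then obtain T u where u: "\<And>s. u s absolutely_integrable_on {0..T}"
    and nonneg: "\<And>s t. t \<in> {0..T} \<Longrightarrow> 0 \<le> u s t" and y: "(\<chi> i. y0 i - a) = displacement A B T u"
    unfolding displacements_def by fastforce
  define \<alpha> where "\<alpha> s = integral {0..T} (\<lambda>r. exp (- c * r) * u s r)" for s
  have "(\<lambda>r. exp (- c * r) * u s r) absolutely_integrable_on {0..T}" for s
  proof (rule absolutely_integrable_bounded_measurable_product_real[OF _ _ _ u])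
    have cont: "continuous_on {0..T} (\<lambda>r. exp (- c * r))" by (intro continuous_intros)
    show "(\<lambda>r. exp (- c * r)) \<in> borel_measurable (lebesgue_on {0..T})"
      by (rule continuous_imp_measurable_on_sets_lebesgue[OF cont]) auto
    show "bounded ((\<lambda>r. exp (- c * r)) ` {0..T})"
      using compact_continuous_image[OF cont] by (simp add: compact_imp_bounded)
  qed auto
  then have \<alpha>: "((\<lambda>r. exp (- c * r) * u s r) has_integral \<alpha> s) {0..T}" for s
    unfolding \<alpha>_def by (intro integrable_integral set_lebesgue_integral_eq_integral(1))
  have \<alpha>_nonneg: "0 \<le> \<alpha> s" for s
    by (rule has_integral_nonneg[OF \<alpha>]) (use nonneg in auto)
  have "w (i, j) = (\<Sum>s\<in>UNIV. (v j \<bullet> B i s) * \<alpha> s)" if j: "j < d" for i j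
  proof -
    have eig: "transpose A *v v j = c *\<^sub>R v j"
      unfolding v_def by (rule real_columns_eigenvectors[OF V j])
    have "v j \<bullet> a = (\<Sum>i\<in>UNIV. w (i, j)) / CARD('q)"
      by (simp add: a_def inner_sum_right y0[OF j] divide_inverse_commute)
    then have "v j \<bullet> (y0 i - a) = w (i, j)"
      using w j by (simp add: S_perp_iff inner_diff_right y0)
    then have "w (i, j) = v j \<bullet> displacement A B T u $ i"
      using y by (metis vec_lambda_beta)
    moreover have "((\<lambda>r. v j \<bullet> (matrix_exp A (- r) *v (\<Sum>s\<in>UNIV. u s r *\<^sub>R B i s)))
        has_integral v j \<bullet> displacement A B T u $ i) {0..T}"
      using has_integral_linear[OF displacement_has_integral[where u = u, OF u] bounded_linear_inner_right]
      by (simp add: o_def)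
    moreover have "((\<lambda>r. \<Sum>s\<in>UNIV. (v j \<bullet> B i s) * (exp (- c * r) * u s r))
        has_integral (\<Sum>s\<in>UNIV. (v j \<bullet> B i s) * \<alpha> s)) {0..T}"
      by (intro has_integral_sum has_integral_mult_right \<alpha>) auto
    moreover have "v j \<bullet> (matrix_exp A (- r) *v (\<Sum>s\<in>UNIV. u s r *\<^sub>R B i s))
        = (\<Sum>s\<in>UNIV. (v j \<bullet> B i s) * (exp (- c * r) * u s r))" for r
      unfolding inner_matrix_exp_eigenvector[OF eig]
      by (simp add: inner_sum_right sum_distrib_left mult_ac)
    ultimately show ?thesis using has_integral_unique by simp
  qed
  then have "w = mat_apply (block_rows d) UNIV ?G \<alpha>"
    using w unfolding real_inc_apply
    by (auto simp: fun_eq_iff S_perp_iff block_space_def block_rows_def v_def)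
  with \<alpha>_nonneg show "w \<in> mat_cone d ?G"
    unfolding mat_cone_def by blast
qed

text \<open>
  Write the blocks of \<open>\<eta>\<close> in terms of the columns of \<open>V\<close> and let \<open>b\<close> be minus the coordinate vector.
  If \<open>b = G \<alpha>\<close> with \<open>\<alpha> \<ge> 0\<close>, then \<open>\<parallel>b\<parallel>\<^sup>2\<close> equals
  \<open>- \<Sum>\<^sub>s \<alpha>\<^sub>s \<Sum>\<^sub>i \<eta>\<^sub>i \<bullet> B\<^sub>i\<^sub>s\<close>, which is at most zero because the response at time \<open>0\<close> of a
  costate in the dual cone is nonnegative. So \<open>b = 0\<close>, and \<open>\<eta> = 0\<close>.
\<close>

lemma not_strongly_connected_if_eigenvector_in_dual_cone:
  fixes A :: "real^'n^'n" and B :: "'q::finite \<Rightarrow> 'p::finite \<Rightarrow> real^'n"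
  assumes V: "eigenvector_matrix (conj_transpose (map_matrix complex_of_real A)) (complex_of_real c) d V"
    and \<eta>: "\<eta> \<in> dual_cone A B" "\<eta> \<noteq> 0" and eig: "\<And>i. transpose A *v (\<eta> $ i) = c *\<^sub>R (\<eta> $ i)"
  shows "\<not> strongly_connected d (real_matrix (inc (\<lambda>i s. conj_transpose_mult V (B i s))))"
    (is "\<not> strongly_connected d ?G")
proof
  assume sc: "strongly_connected d ?G"
  define v where "v j = Re_vec (V j)" for j
  have "\<exists>z. \<forall>i. \<eta> $ i = (\<Sum>j<d. z i j *\<^sub>R v j)"
    unfolding v_def by (intro choice allI) (metis real_columns_span[OF V eig])
  then obtain z where z: "\<And>i. \<eta> $ i = (\<Sum>j<d. z i j *\<^sub>R v j)" by blast
  define a where "a j = (\<Sum>i\<in>UNIV. z i j) / CARD('q)" for j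
  \<comment> \<open>Subtracting the average \<open>a\<close> of the coordinates puts \<open>b\<close> into the complement; it does not affect the vectors represented, as the blocks of \<open>\<eta>\<close> sum to zero.\<close>
  define b where "b = (\<lambda>(i, j). if j < d then a j - z i j else 0)"
  have "b \<in> S_perp d"
    by (auto simp: S_perp_iff b_def block_space_def block_rows_def sum_subtractf a_def)
  then obtain \<alpha> where \<alpha>: "\<And>s. 0 \<le> \<alpha> s" and b: "b = mat_apply (block_rows d) UNIV ?G \<alpha>"
    using sc unfolding strongly_connected_def mat_cone_def by blast
  have b_eq: "b (i, j) = (\<Sum>s\<in>UNIV. (v j \<bullet> B i s) * \<alpha> s)" if "j < d" for i j
    using that unfolding b real_inc_apply by (simp add: v_def)
  have "(\<Sum>j<d. a j *\<^sub>R v j) = (\<Sum>i\<in>UNIV. \<eta> $ i) /\<^sub>R CARD('q)"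
  proof -
    have "(\<Sum>i\<in>UNIV. \<eta> $ i) = (\<Sum>j<d. (\<Sum>i\<in>UNIV. z i j) *\<^sub>R v j)"
      unfolding z by (subst sum.swap) (simp add: scaleR_sum_left)
    then show ?thesis by (simp add: a_def scaleR_sum_right divide_inverse_commute)
  qed
  then have avg: "(\<Sum>j<d. a j *\<^sub>R v j) = 0"
    using \<eta>(1) by (simp add: dual_cone_def relative_space_def)
  have \<eta>_eq: "\<eta> $ i = - (\<Sum>j<d. b (i, j) *\<^sub>R v j)" for i
    using avg by (simp add: b_def z[of i] scaleR_diff_left sum_subtractf)
  have "(\<Sum>i\<in>UNIV. \<Sum>j<d. (b (i, j))\<^sup>2) = (\<Sum>i\<in>UNIV. \<Sum>j<d. \<Sum>s\<in>UNIV. \<alpha> s * ((b (i, j) *\<^sub>R v j) \<bullet> B i s))"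
    by (intro sum.cong) (auto simp: power2_eq_square b_eq sum_distrib_left sum_distrib_right mult_ac)
  also have "\<dots> = (\<Sum>i\<in>UNIV. \<Sum>s\<in>UNIV. \<alpha> s * ((\<Sum>j<d. b (i, j) *\<^sub>R v j) \<bullet> B i s))"
    by (subst sum.swap) (simp add: inner_sum_left sum_distrib_left)
  also have "\<dots> = (\<Sum>s\<in>UNIV. \<Sum>i\<in>UNIV. - (\<alpha> s * (\<eta> $ i \<bullet> B i s)))"
    by (subst sum.swap) (simp add: \<eta>_eq)
  also have "\<dots> = - (\<Sum>s\<in>UNIV. \<alpha> s * response A B \<eta> s 0)"
    by (simp add: response_def sum_distrib_left sum_negf)
  also have "\<dots> \<le> 0"
    using \<alpha> \<eta>(1) by (auto simp: dual_cone_def intro!: sum_nonneg mult_nonneg_nonneg)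
  finally have "(\<Sum>i\<in>UNIV. \<Sum>j<d. (b (i, j))\<^sup>2) = 0"
    by (intro antisym sum_nonneg) auto
  then have "\<forall>i. \<forall>j<d. b (i, j) = 0"
    by (simp add: sum_nonneg_eq_0_iff sum_nonneg)
  then have "\<eta> = 0" by (simp add: vec_eq_iff \<eta>_eq)
  with \<eta>(2) show False by simp
qed

theorem theorem2:
  fixes A :: "real^'n^'n"
    and B :: "'q::finite \<Rightarrow> 'p::finite \<Rightarrow> real^'n"
    and m :: nat
    and mu :: "nat \<Rightarrow> complex"
    and d :: "nat \<Rightarrow> nat"
    and V :: "nat \<Rightarrow> nat \<Rightarrow> complex^'n"
  defines "Astar \<equiv> conj_transpose (map_matrix complex_of_real A)"
  assumes "CARD('q) \<ge> 2"
    and "relative_actuation B"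
    and "bij_betw mu {1..m} {z. eigenvalue Astar z}"
    and "\<And>\<kappa>. \<kappa> \<in> {1..m} \<Longrightarrow> eigenvector_matrix Astar (mu \<kappa>) (d \<kappa>) (V \<kappa>)"
  shows "positively_controllable A B \<longleftrightarrow>
    controllable A B \<and>
    (\<forall>\<kappa>\<in>{1..m}. mu \<kappa> \<in> \<real> \<longrightarrow>
      strongly_connected (d \<kappa>)
        (real_matrix (inc (\<lambda>i s. conj_transpose_mult (V \<kappa>) (B i s)))))"
proof (intro iffI conjI ballI impI)
  assume pos: "positively_controllable A B"
  then show "controllable A B"
    unfolding positively_controllable_def controllable_def by metis
  fix \<kappa> assume \<kappa>: "\<kappa> \<in> {1..m}" "mu \<kappa> \<in> \<real>"
  then obtain c where "mu \<kappa> = complex_of_real c" by (auto elim: Reals_cases)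
  with assms(5)[OF \<kappa>(1)] show "strongly_connected (d \<kappa>)
      (real_matrix (inc (\<lambda>i s. conj_transpose_mult (V \<kappa>) (B i s))))"
    unfolding Astar_def
    by (intro strongly_connected_if_positively_controllable[OF assms(3) pos, of c]) simp
next
  assume asm: "controllable A B \<and> (\<forall>\<kappa>\<in>{1..m}. mu \<kappa> \<in> \<real> \<longrightarrow>
      strongly_connected (d \<kappa>) (real_matrix (inc (\<lambda>i s. conj_transpose_mult (V \<kappa>) (B i s)))))"
  show "positively_controllable A B"
  proof (rule ccontr)
    assume "\<not> positively_controllable A B"
    then obtain \<eta> c where \<eta>: "\<eta> \<in> dual_cone A B" "\<eta> \<noteq> 0"
      and eig: "\<And>i. transpose A *v (\<eta> $ i) = c *\<^sub>R (\<eta> $ i)"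
      using eigenvector_in_dual_cone[OF assms(3)] asm by metis
    obtain i where i: "\<eta> $ i \<noteq> 0"
      using \<eta>(2) by (auto simp: vec_eq_iff)
    have "of_real_vec (\<eta> $ i) \<noteq> 0"
      using i by (simp add: of_real_vec_def vec_eq_iff)
    moreover have "Astar *v of_real_vec (\<eta> $ i) = complex_of_real c *s of_real_vec (\<eta> $ i)"
      unfolding Astar_def mult_of_real_vec eig by (simp add: of_real_vec_def vec_eq_iff)
    ultimately have "eigenvalue Astar (complex_of_real c)"
      unfolding eigenvalue_def by blast
    then have "complex_of_real c \<in> mu ` {1..m}"
      using assms(4) unfolding bij_betw_def by simp
    then obtain \<kappa> where \<kappa>: "\<kappa> \<in> {1..m}" "mu \<kappa> = complex_of_real c"
      by (metis imageE)
    then have "eigenvector_matrix (conj_transpose (map_matrix complex_of_real A)) (complex_of_real c) (d \<kappa>) (V \<kappa>)"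
      using assms(5) unfolding Astar_def by metis
    from not_strongly_connected_if_eigenvector_in_dual_cone[OF this \<eta> eig] asm \<kappa>
    show False by auto
  qed
qed

end
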